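(* Let $\pi$ be any one of Algorithms 1, 2, 3 (described in the context), applied in a setting where it earns expected revenue at least $\alpha\cdot\mathsf{OPT}_{\mathrm{LP}}$, and let $\epsilon>0$. Then the static (deterministic) calendar $\hat S_1,\dots,\hat S_T$ produced by Algorithm 4 initialized with the distribution $\bm z$ of $\pi$ earns expected revenue (expectation over demands and over the simulation randomness) at least $(\alpha-\epsilon)\cdot\mathsf{OPT}_{\mathrm{LP}}$. The time complexity of Algorithm 4 is $$O\!\left(\frac{(b_1+\cdots+b_n)^2p_{\max}^2}{\mathsf{OPT}_{\mathrm{LP}}^2}\cdot\frac{1}{\epsilon^2}\,n^2T^4(\log n+\log T)\right).$$
   Context: Model. A firm sells $n$ items over $T$ periods; item $i$ has starting inventory $b_i$ ($1\le b_i\le T$). Prices $p_1,\dots,p_m>0$, $p_{\max}=\max_j p_j$; products are pairs $(i,j)$ (item $i$ at price $p_j$). $\mathcal S$ is a downward-closed family of subsets of $[n]\times[m]$ (assortments), $\emptyset\in\mathcal S$. A static policy fixes at the start assortments $S_1,\dots,S_T$; in period $t$ customer demand for products of the shown assortment is drawn independently across periods (integral or fractional demand, static or dynamic substitution as in the respective algorithm's setting), with $q_t(i,j,S)$ the expected demand of $(i,j)$ when $S$ is shown in period $t$ ($q_t=q$ for stationary demand). $\mathsf{OPT}_{\mathrm{LP}}$ is the optimal value of CDLP-S for stationary demand (maximize $T\sum_S x(S)\sum_{(i,j)\in S}p_jq(i,j,S)$ s.t. $T\sum_Sx(S)\sum_{j:(i,j)\in S}q(i,j,S)\le b_i$ $\forall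 i$, $\sum_Sx(S)=1$, $x\ge0$) and of CDLP-N otherwise (maximize $\sum_t\sum_Sx_t(S)\sum_{(i,j)\in S}p_jq_t(i,j,S)$ s.t. $\sum_t\sum_Sx_t(S)\sum_{j:(i,j)\in S}q_t(i,j,S)\le b_i$ $\forall i$, $\sum_Sx_t(S)=1$ $\forall t$, $x\ge0$). Algorithm 1 (stationary): with $x^*$ optimal for CDLP-S, independently set $S_t=S$ w.p. $x^*(S)$. Algorithm 2: with $x^*$ optimal for CDLP-N and $r^*_i=\sum_t\sum_Sx^*_t(S)\sum_{j:(i,j)\in S}p_jq_t(i,j,S)$, independently draw $\tilde S_t=S$ w.p. $x^*_t(S)$ and offer $\{(i,j)\in\tilde S_t:p_j>r^*_i/(2b_i)\}$. Algorithm 3: with $x^*$ optimal for CDLP-N and $\delta=\sqrt{3\log(\min_ib_i)/\min_ib_i}$, independently offer $S$ w.p. $(1-\delta)x^*_t(S)$ and $\emptyset$ w.p. $\delta$. Each of these induces a vector $\bm z=(z_t(S))$ with $z_t(S)=\Pr[S_t=S]$, periods independent. Simulator: $\nu(\bm z,\xi)$ draws independently $S_t\sim z_t(\cdot)$ for each $t$, then draws demands according to the demand model and returns the realized revenue (a value in $[0,(b_1+\cdots+b_n)p_{\max}]$), using randomness $\xi$. Algorithm 4: set $K=\lceil \frac{T^2(b_1+\cdots+b_n)^2p_{\max}^2}{\mathsf{OPT}_{\mathrm{LP}}^2}\cdot\frac1{\epsilon^2}(\log n+\log T)\rceil$. For $t=1,\dots,T$: for each $S$ with $z_t(S)>0$,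 let $\hat\mu_K(\bm z\mid S_t=S)$ be the average of $K$ independent simulator runs on the vector obtained from $\bm z$ by making $z_t$ the point mass at $S$; choose $\hat S_t$ maximizing this estimate; update $z_t$ to the point mass at $\hat S_t$. Output the calendar $\hat S_1,\dots,\hat S_T$. Time complexity counts arithmetic operations, with sampling one period's demand counted as $O(1)$.
   Formalization: The optimal x* in Algorithms 1–3 is taken to be a basic optimal solution (vertex) of the LP, and the time bound is claimed only for ε ≤ 1, OPT_LP > 0 and nT ≥ 2; without these the claims fail or are undefined. *)

theory Defs
  imports "HOL-Probability.Probability"
begin

text \<open>Items are 0, ..., n - 1, price indices 0, ..., m - 1 and periods 0, ..., T - 1.\<close>

type_synonym product = "nat \<times> nat"
type_synonym assortment = "product set"

text \<open>
  The random outcome of one period is a table giving, for every assortment \<open>S\<close> that might be shown,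
  the quantity demanded of every product. Only the entry of the assortment actually faced by the
  customer is ever read, so the dependence between the entries of different assortments is
  immaterial, and every family (indexed by the assortments) of distributions of demand vectors
  arises in this way.
\<close>
type_synonym customer = "assortment \<Rightarrow> product \<Rightarrow> real"

datatype substitution = Static | Dynamic

record model =
  num_items :: nat
  num_prices :: nat
  horizon :: nat
  inventory :: "nat \<Rightarrow> real"
  price :: "nat \<Rightarrow> real"
  assortments :: "assortment set"
  substitution :: substitution
  customer_law :: "nat \<Rightarrow> customer measure"

text \<open>
  Demand is fractional: an item is demanded in a quantity between 0 and 1 per period. Integral demand
  is the special case in which every table entry is a 0/1 vector with at most one 1 and the
  inventories are whole numbers.
\<close>
definition valid_model :: "model \<Rightarrow> bool" where
  "valid_model M \<longleftrightarrow>
     1 \<le> num_items M \<and> 1 \<le> num_prices M \<and>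
     (\<forall>i<num_items M. 1 \<le> inventory M i \<and> inventory M i \<le> real (horizon M)) \<and>
     (\<forall>j<num_prices M. 0 < price M j) \<and>
     assortments M \<subseteq> Pow ({..<num_items M} \<times> {..<num_prices M}) \<and>
     {} \<in> assortments M \<and>
     (\<forall>S\<in>assortments M. \<forall>S'. S' \<subseteq> S \<longrightarrow> S' \<in> assortments M) \<and>
     (\<forall>t<horizon M.
        prob_space (customer_law M t) \<and>
        (\<forall>S\<in>assortments M. \<forall>x. (\<lambda>\<theta>. \<theta> S x) \<in> borel_measurable (customer_law M t)) \<and>
        (\<forall>\<theta>\<in>space (customer_law M t). \<forall>S\<in>assortments M.
           (\<forall>x. 0 \<le> \<theta> S x) \<and> (\<forall>x. x \<notin> S \<longrightarrow> \<theta> S x = 0) \<and>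
           (\<forall>i<num_items M. (\<Sum>j<num_prices M. \<theta> S (i, j)) \<le> 1)))"

definition p_max :: "model \<Rightarrow> real" where
  "p_max M = Max (price M ` {..<num_prices M})"

definition total_inventory :: "model \<Rightarrow> real" where
  "total_inventory M = (\<Sum>i<num_items M. inventory M i)"

definition min_inventory :: "model \<Rightarrow> real" where
  "min_inventory M = Min (inventory M ` {..<num_items M})"


subsection \<open>The linear programs\<close>

definition q :: "model \<Rightarrow> nat \<Rightarrow> assortment \<Rightarrow> product \<Rightarrow> real" where
  "q M t S x = (\<integral>\<theta>. \<theta> S x \<partial>customer_law M t)"

definition stationary :: "model \<Rightarrow> bool" where
  "stationary M \<longleftrightarrow> (\<forall>t<horizon M. \<forall>S\<in>assortments M. \<forall>x\<in>S. q M t S x = q M 0 S x)"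

definition reward :: "model \<Rightarrow> nat \<Rightarrow> assortment \<Rightarrow> real" where
  "reward M t S = (\<Sum>(i, j)\<in>S. price M j * q M t S (i, j))"

definition item_reward :: "model \<Rightarrow> nat \<Rightarrow> nat \<Rightarrow> assortment \<Rightarrow> real" where
  "item_reward M t i S = (\<Sum>j | (i, j) \<in> S. price M j * q M t S (i, j))"

definition usage :: "model \<Rightarrow> nat \<Rightarrow> nat \<Rightarrow> assortment \<Rightarrow> real" where
  "usage M t i S = (\<Sum>j | (i, j) \<in> S. q M t S (i, j))"

definition cdlp_S_feasible :: "model \<Rightarrow> (assortment \<Rightarrow> real) set" where
  "cdlp_S_feasible M = {x.
     (\<forall>S. 0 \<le> x S) \<and> (\<forall>S. S \<notin> assortments M \<longrightarrow> x S = 0) \<and>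
     (\<Sum>S\<in>assortments M. x S) = 1 \<and>
     (\<forall>i<num_items M.
        real (horizon M) * (\<Sum>S\<in>assortments M. x S * usage M 0 i S) \<le> inventory M i)}"

definition cdlp_S_value :: "model \<Rightarrow> (assortment \<Rightarrow> real) \<Rightarrow> real" where
  "cdlp_S_value M x = real (horizon M) * (\<Sum>S\<in>assortments M. x S * reward M 0 S)"

definition cdlp_N_feasible :: "model \<Rightarrow> (nat \<times> assortment \<Rightarrow> real) set" where
  "cdlp_N_feasible M = {x.
     (\<forall>t S. 0 \<le> x (t, S)) \<and>
     (\<forall>t S. \<not> (t < horizon M \<and> S \<in> assortments M) \<longrightarrow> x (t, S) = 0) \<and>
     (\<forall>t<horizon M. (\<Sum>S\<in>assortments M. x (t, S)) = 1) \<and>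
     (\<forall>i<num_items M.
        (\<Sum>t<horizon M. \<Sum>S\<in>assortments M. x (t, S) * usage M t i S) \<le> inventory M i)}"

definition cdlp_N_value :: "model \<Rightarrow> (nat \<times> assortment \<Rightarrow> real) \<Rightarrow> real" where
  "cdlp_N_value M x = (\<Sum>t<horizon M. \<Sum>S\<in>assortments M. x (t, S) * reward M t S)"

definition opt_lp :: "model \<Rightarrow> real" where
  "opt_lp M = (if stationary M then (SUP x\<in>cdlp_S_feasible M. cdlp_S_value M x)
               else (SUP x\<in>cdlp_N_feasible M. cdlp_N_value M x))"

text \<open>
  An optimal LP solution is taken to be a basic one, i.e. a vertex (extreme point) of the feasible
  polytope. The number of assortments used by an arbitrary optimal solution is not bounded in
  terms of \<open>n\<close> and \<open>T\<close>.
\<close>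
definition vertex_of :: "('k \<Rightarrow> real) \<Rightarrow> ('k \<Rightarrow> real) set \<Rightarrow> bool" where
  "vertex_of x P \<longleftrightarrow> x \<in> P \<and>
     \<not> (\<exists>y\<in>P. \<exists>z\<in>P. \<exists>u. y \<noteq> z \<and> 0 < u \<and> u < 1 \<and> x = (\<lambda>k. (1 - u) * y k + u * z k))"

definition optimal_vertex :: "(('k \<Rightarrow> real) \<Rightarrow> real) \<Rightarrow> ('k \<Rightarrow> real) set \<Rightarrow> ('k \<Rightarrow> real) \<Rightarrow> bool" where
  "optimal_vertex f P x \<longleftrightarrow> vertex_of x P \<and> (\<forall>y\<in>P. f y \<le> f x)"


subsection \<open>Static policies\<close>

text \<open>
  A randomized static policy with independent periods is given by \<open>z\<close>, where \<open>pmf (z t) S\<close> is the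
  probability of showing \<open>S\<close> in period \<open>t\<close>; only the periods below the horizon matter.
\<close>
type_synonym policy = "nat \<Rightarrow> assortment pmf"

definition algorithm1 :: "model \<Rightarrow> policy \<Rightarrow> bool" where
  "algorithm1 M z \<longleftrightarrow> stationary M \<and>
     (\<exists>x. optimal_vertex (cdlp_S_value M) (cdlp_S_feasible M) x \<and>
          (\<forall>t<horizon M. \<forall>S. pmf (z t) S = x S))"

definition r_star :: "model \<Rightarrow> (nat \<times> assortment \<Rightarrow> real) \<Rightarrow> nat \<Rightarrow> real" where
  "r_star M x i = (\<Sum>t<horizon M. \<Sum>S\<in>assortments M. x (t, S) * item_reward M t i S)"

definition discard_cheap ::
  "model \<Rightarrow> (nat \<times> assortment \<Rightarrow> real) \<Rightarrow> assortment \<Rightarrow> assortment" where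
  "discard_cheap M x S = {(i, j) \<in> S. price M j > r_star M x i / (2 * inventory M i)}"

definition algorithm2 :: "model \<Rightarrow> policy \<Rightarrow> bool" where
  "algorithm2 M z \<longleftrightarrow>
     (\<exists>x y. optimal_vertex (cdlp_N_value M) (cdlp_N_feasible M) x \<and>
            (\<forall>t<horizon M. (\<forall>S. pmf (y t) S = x (t, S)) \<and> z t = map_pmf (discard_cheap M x) (y t)))"

definition delta :: "model \<Rightarrow> real" where
  "delta M = sqrt (3 * ln (min_inventory M) / min_inventory M)"

definition algorithm3 :: "model \<Rightarrow> policy \<Rightarrow> bool" where
  "algorithm3 M z \<longleftrightarrow>
     (\<exists>x. optimal_vertex (cdlp_N_value M) (cdlp_N_feasible M) x \<and>
          (\<forall>t<horizon M. \<forall>S.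
             pmf (z t) S = (1 - delta M) * x (t, S) + (if S = {} then delta M else 0)))"


subsection \<open>The simulator\<close>

text \<open>
  The state consists of the remaining stock, the revenue earned so far and the number of operations
  performed so far.

  An item demanded in total quantity \<open>u\<close> while \<open>c\<close> units are in stock is sold in quantity
  \<open>min u c\<close>; if it is demanded at several prices at once, all of them are served in the
  same proportion. (For \<open>u = 0\<close> the proportion evaluates to \<open>min 1 0 = 0\<close>.) Under static
  substitution the demand is that for the assortment shown; under dynamic substitution it is that
  for the subset of its products that are still in stock.
\<close>
type_synonym sim_state = "(nat \<Rightarrow> real) \<times> real \<times> nat"

definition faced :: "model \<Rightarrow> (nat \<Rightarrow> real) \<Rightarrow> assortment \<Rightarrow> assortment" where
  "faced M c S = (case substitution M of Static \<Rightarrow> S | Dynamic \<Rightarrow> {(i, j) \<in> S. 0 < c i})"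

definition units :: "model \<Rightarrow> (product \<Rightarrow> real) \<Rightarrow> nat \<Rightarrow> real" where
  "units M d i = (\<Sum>j<num_prices M. d (i, j))"

definition spend :: "model \<Rightarrow> (product \<Rightarrow> real) \<Rightarrow> nat \<Rightarrow> real" where
  "spend M d i = (\<Sum>j<num_prices M. price M j * d (i, j))"

text \<open>
  Operations in one period: one for a uniform random number, an addition and a comparison for
  each element of the support of \<open>z t\<close> (sampling the assortment by inversion), one for sampling the
  period's demand (delivering \<open>units\<close> and \<open>spend\<close> of each item), and eight for each item: the
  tests \<open>c i > 0\<close> and \<open>units = 0\<close>, a division, a minimum, two multiplications, a subtraction
  (stock), an addition (revenue).
\<close>
definition sim_step ::
  "model \<Rightarrow> policy \<Rightarrow> nat \<Rightarrow> assortment \<times> customer \<Rightarrow> sim_state \<Rightarrow> sim_state" where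
  "sim_step M z t = (\<lambda>(S, \<theta>) (c, r, k).
     let d = \<theta> (faced M c S);
         f = (\<lambda>i. min 1 (c i / units M d i))
     in (\<lambda>i. c i - units M d i * f i,
         r + (\<Sum>i<num_items M. spend M d i * f i),
         k + 2 + 2 * card (set_pmf (z t)) + 8 * num_items M))"

primrec simulate ::
  "model \<Rightarrow> policy \<Rightarrow> (nat \<Rightarrow> assortment \<times> customer) \<Rightarrow> nat \<Rightarrow> sim_state" where
  "simulate M z \<omega> 0 = (inventory M, 0, num_items M)"
| "simulate M z \<omega> (Suc t) = sim_step M z t (\<omega> t) (simulate M z \<omega> t)"

definition sim_revenue :: "model \<Rightarrow> policy \<Rightarrow> (nat \<Rightarrow> assortment \<times> customer) \<Rightarrow> real" where
  "sim_revenue M z \<omega> = fst (snd (simulate M z \<omega> (horizon M)))"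

definition sim_ops :: "model \<Rightarrow> policy \<Rightarrow> (nat \<Rightarrow> assortment \<times> customer) \<Rightarrow> nat" where
  "sim_ops M z \<omega> = snd (snd (simulate M z \<omega> (horizon M)))"

text \<open>
  The restriction to the assortments of the model removes a null set only; it is needed because
  \<open>(S, \<theta>) \<mapsto> \<theta> S x\<close> need not be measurable when \<open>S\<close> ranges over the whole (uncountable) type.
\<close>
definition sim_space :: "model \<Rightarrow> policy \<Rightarrow> (nat \<Rightarrow> assortment \<times> customer) measure" where
  "sim_space M z = PiM {..<horizon M}
     (\<lambda>t. restrict_space (measure_pmf (z t)) (assortments M) \<Otimes>\<^sub>M customer_law M t)"

definition expected_revenue :: "model \<Rightarrow> policy \<Rightarrow> real" where
  "expected_revenue M z = (\<integral>\<omega>. sim_revenue M z \<omega> \<partial>sim_space M z)"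

definition calendar :: "assortment list \<Rightarrow> policy" where
  "calendar h = (\<lambda>t. return_pmf (h ! t))"


subsection \<open>Algorithm 4\<close>

definition num_runs :: "model \<Rightarrow> real \<Rightarrow> nat" where
  "num_runs M \<epsilon> = nat \<lceil>(real (horizon M))\<^sup>2 * (total_inventory M)\<^sup>2 * (p_max M)\<^sup>2 / (opt_lp M)\<^sup>2
     * (1 / \<epsilon>\<^sup>2) * (ln (real (num_items M)) + ln (real (horizon M)))\<rceil>"

definition pin :: "policy \<Rightarrow> assortment list \<Rightarrow> policy" where
  "pin z h = (\<lambda>t. if t < length h then return_pmf (h ! t) else z t)"

text \<open>
  \<open>sel h A\<close> is the element chosen among the maximizers \<open>A\<close> of the estimates when \<open>h\<close> is the
  calendar fixed so far.
\<close>
type_synonym tie_break = "assortment list \<Rightarrow> assortment set \<Rightarrow> assortment"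

definition valid_tie_break :: "tie_break \<Rightarrow> bool" where
  "valid_tie_break sel \<longleftrightarrow> (\<forall>h A. finite A \<and> A \<noteq> {} \<longrightarrow> sel h A \<in> A)"

definition estimate ::
  "model \<Rightarrow> policy \<Rightarrow> nat \<Rightarrow> assortment list \<Rightarrow>
     (assortment \<times> nat \<Rightarrow> nat \<Rightarrow> assortment \<times> customer) \<Rightarrow> assortment \<Rightarrow> real" where
  "estimate M z K h \<omega> S = (\<Sum>k<K. sim_revenue M (pin z (h @ [S])) (\<omega> (S, k))) / real K"

text \<open>The law of a random variable that takes countably many values.\<close>
definition discrete_law :: "'a measure \<Rightarrow> ('a \<Rightarrow> 'b) \<Rightarrow> 'b pmf" where
  "discrete_law P f = embed_pmf (\<lambda>y. measure P {\<omega> \<in> space P. f \<omega> = y})"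

text \<open>
  One iteration, in period \<open>length h\<close>, with \<open>c\<close> operations performed before. Operations for each
  candidate: pinning it (1), the runs, an addition for each run, a division and a comparison. One
  more operation updates \<open>z\<close>.
\<close>
definition alg4_step ::
  "model \<Rightarrow> policy \<Rightarrow> tie_break \<Rightarrow> nat \<Rightarrow> assortment list \<times> nat \<Rightarrow> (assortment list \<times> nat) pmf" where
  "alg4_step M z sel K = (\<lambda>(h, c).
     let C = set_pmf (z (length h)) in
     discrete_law (PiM (C \<times> {..<K}) (\<lambda>(S, k). sim_space M (pin z (h @ [S]))))
       (\<lambda>\<omega>. let e = estimate M z K h \<omega> in
          (h @ [sel h {S \<in> C. \<forall>S'\<in>C. e S' \<le> e S}],
           c + (\<Sum>S\<in>C. 3 + (\<Sum>k<K. sim_ops M (pin z (h @ [S])) (\<omega> (S, k)) + 1)) + 1)))"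

primrec alg4_run ::
  "model \<Rightarrow> policy \<Rightarrow> tie_break \<Rightarrow> nat \<Rightarrow> nat \<Rightarrow> nat \<Rightarrow> (assortment list \<times> nat) pmf" where
  "alg4_run M z sel K c 0 = return_pmf ([], c)"
| "alg4_run M z sel K c (Suc t) = bind_pmf (alg4_run M z sel K c t) (alg4_step M z sel K)"

text \<open>
  Joint law of the calendar produced and the number of operations used. Computing the number of
  runs per candidate from \<open>p_max\<close> and \<open>opt_lp\<close> takes \<open>n - 1\<close> additions and 15 further operations.
\<close>
definition algorithm4 ::
  "model \<Rightarrow> policy \<Rightarrow> tie_break \<Rightarrow> real \<Rightarrow> (assortment list \<times> nat) pmf" where
  "algorithm4 M z sel \<epsilon> = alg4_run M z sel (num_runs M \<epsilon>) (num_items M + 14) (horizon M)"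

definition time_bound :: "model \<Rightarrow> real \<Rightarrow> real" where
  "time_bound M \<epsilon> = (total_inventory M)\<^sup>2 * (p_max M)\<^sup>2 / (opt_lp M)\<^sup>2 * (1 / \<epsilon>\<^sup>2)
     * (real (num_items M))\<^sup>2 * (real (horizon M)) ^ 4
     * (ln (real (num_items M)) + ln (real (horizon M)))"

end

theory Submission
  imports Defs
begin

text \<open>
  Fixing the period \<open>t\<close> of a policy to \<open>S\<close> and averaging over \<open>S\<close> gives back its expected revenue, so
  fixing it to the best candidate loses nothing; fixing it to the candidate with the largest
  estimate loses at most the expected maximal estimation error. By Hoeffding's lemma the error of an
  average of \<open>K\<close> runs with values in \<open>[0, R]\<close> has moment generating function at most
  \<open>exp (\<lambda>\<^sup>2 R\<^sup>2 / (8 K))\<close>, so the expected maximum over \<open>N\<close> candidates is at most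
  \<open>ln N / \<lambda> + \<lambda> R\<^sup>2 / (8 K)\<close> for every \<open>\<lambda> > 0\<close>. A vertex of the LP
  uses at most \<open>n + 1\<close> assortments in each period: otherwise some nonzero change of the probabilities
  of one period preserves their sum and the \<open>n\<close> expected usages, and moving a little along it in both
  directions stays feasible. Algorithm 3 adds the empty assortment, so \<open>N \<le> n + 2 \<le> (n T)\<^sup>2\<close> unless
  \<open>n = T = 1\<close>; the choice of \<open>K\<close> then makes the loss of each period at most \<open>\<epsilon> OPT / T\<close>. If
  \<open>n = T = 1\<close>, then \<open>K = 0\<close>, but there is only one candidate.
\<close>

section \<open>Supports of vertices\<close>

text \<open>Elimination, by induction on the number of equations: the last equation either has no
  nonzero coefficient on \<open>A\<close> and is dropped, or eliminates a pivot unknown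
  \<open>p\<close>, leaving one equation and one unknown fewer.\<close>

lemma homogeneous_system_nontrivial_solution:
  fixes a :: "nat \<Rightarrow> 'a \<Rightarrow> real"
  assumes "finite A" "n < card A"
  shows "\<exists>d. (\<exists>s\<in>A. d s \<noteq> 0) \<and> (\<forall>i<n. (\<Sum>s\<in>A. a i s * d s) = 0)"
  using assms
proof (induction n arbitrary: A a)
  case 0
  then have "A \<noteq> {}" by auto
  then show ?case by (intro exI[of _ "\<lambda>_. 1"]) auto
next
  case (Suc n)
  show ?case
  proof (cases "\<forall>s\<in>A. a n s = 0")
    case True
    obtain d where d: "\<exists>s\<in>A. d s \<noteq> 0" "\<forall>i<n. (\<Sum>s\<in>A. a i s * d s) = 0"
      using Suc.IH[OF Suc.prems(1), of a] Suc.prems(2) by auto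
    have "(\<Sum>s\<in>A. a n s * d s) = 0" using True by simp
    with d show ?thesis by (intro exI[of _ d]) (auto simp: less_Suc_eq)
  next
    case False
    then obtain p where p: "p \<in> A" "a n p \<noteq> 0" by auto
    define b where "b i s = a i s - a i p * a n s / a n p" for i s
    have "n < card (A - {p})" using Suc.prems p by simp
    then obtain d' where d': "\<exists>s\<in>A - {p}. d' s \<noteq> 0"
        "\<And>i. i < n \<Longrightarrow> (\<Sum>s\<in>A - {p}. b i s * d' s) = 0"
      using Suc.IH[of "A - {p}" b] Suc.prems by auto
    \<comment> \<open>The value at the pivot is the one that equation \<open>n\<close> forces. The
      reduced row \<open>b n\<close> is zero, so the identity \<open>sum\<close> below settles
      equation \<open>n\<close> together with the others.\<close>
    define d where "d = d'(p := - (\<Sum>s\<in>A - {p}. a n s * d' s) / a n p)"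
    have sum: "(\<Sum>s\<in>A. a i s * d s) = (\<Sum>s\<in>A - {p}. b i s * d' s)" for i
    proof -
      have "(\<Sum>s\<in>A. a i s * d s) = a i p * d p + (\<Sum>s\<in>A - {p}. a i s * d s)"
        using Suc.prems p by (intro sum.remove) auto
      also have "(\<Sum>s\<in>A - {p}. a i s * d s) = (\<Sum>s\<in>A - {p}. a i s * d' s)"
        by (intro sum.cong) (auto simp: d_def)
      also have "a i p * d p + \<dots> = (\<Sum>s\<in>A - {p}. b i s * d' s)"
        proof -
        have "(\<Sum>s\<in>A - {p}. b i s * d' s)
            = (\<Sum>s\<in>A - {p}. a i s * d' s) - a i p / a n p * (\<Sum>s\<in>A - {p}. a n s * d' s)"
          unfolding b_def sum_distrib_left sum_subtractf[symmetric]
          by (intro sum.cong) (simp_all add: algebra_simps)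
        then show ?thesis by (simp add: d_def)
      qed
      finally show ?thesis .
    qed
    have "(\<Sum>s\<in>A. a i s * d s) = 0" if "i < Suc n" for i
      using that d' p by (cases "i = n") (auto simp: sum b_def)
    moreover have "\<exists>s\<in>A. d s \<noteq> 0" using d'(1) by (auto simp: d_def)
    ultimately show ?thesis by (intro exI[of _ d]) auto
  qed
qed

text \<open>Supplies the step length of a move along \<open>d\<close> that keeps finitely many
  positive coordinates nonnegative in both directions.\<close>

lemma scaling_below_positive:
  fixes x d :: "'a \<Rightarrow> real"
  assumes "finite A" "\<And>s. s \<in> A \<Longrightarrow> 0 < x s"
  shows "\<exists>\<eta>>0. \<forall>s\<in>A. \<bar>\<eta> * d s\<bar> \<le> x s"
  using assms
proof (induction A)
  case empty
  then show ?case by (intro exI[of _ 1]) auto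
next
  case (insert s A)
  then obtain \<eta> where \<eta>: "\<eta> > 0" "\<forall>s\<in>A. \<bar>\<eta> * d s\<bar> \<le> x s" by auto
  \<comment> \<open>The summand 1 keeps the denominator positive when
    \<open>d s = 0\<close>.\<close>
  define \<theta> where "\<theta> = min \<eta> (x s / (1 + \<bar>d s\<bar>))"
  have pos: "\<theta> > 0" using \<eta> insert.prems[of s] by (auto simp: \<theta>_def)
  have "\<bar>\<theta> * d u\<bar> \<le> x u" if "u \<in> A" for u
  proof -
    have "\<bar>\<theta> * d u\<bar> \<le> \<bar>\<eta> * d u\<bar>"
      using pos by (auto simp: abs_mult \<theta>_def intro!: mult_right_mono)
    with \<eta>(2) that show ?thesis by fastforce
  qed
  moreover have "\<bar>\<theta> * d s\<bar> \<le> x s"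
  proof -
    have "\<bar>\<theta> * d s\<bar> \<le> x s / (1 + \<bar>d s\<bar>) * \<bar>d s\<bar>"
      using pos unfolding abs_mult by (intro mult_right_mono) (simp_all add: \<theta>_def)
    also have "\<dots> \<le> x s" using insert.prems[of s] by (simp add: field_simps)
    finally show ?thesis .
  qed
  ultimately show ?case using pos by auto
qed

text \<open>\<open>x\<close> is the midpoint of the two perturbed points, and a vertex is no proper
  convex combination of distinct feasible points.\<close>

lemma vertex_of_perturbation:
  assumes "vertex_of x P" "(\<lambda>k. x k + d k) \<in> P" "(\<lambda>k. x k - d k) \<in> P"
  shows "d k = 0"
proof (rule ccontr)
  assume "d k \<noteq> 0"
  then have "(\<lambda>k. x k + d k) \<noteq> (\<lambda>k. x k - d k)" by (auto dest!: fun_cong[of _ _ k])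
  moreover have "x = (\<lambda>k. (1 - 1/2) * (x k + d k) + 1/2 * (x k - d k))" by (auto simp: field_simps)
  moreover have "(0::real) < 1/2" "(1/2::real) < 1" by simp_all
  ultimately show False using assms unfolding vertex_of_def by blast
qed

text \<open>More than \<open>m + 1\<close> positive coordinates would admit a nonzero direction that
  annihilates the \<open>m\<close> rows \<open>a i\<close> and the total mass, contradicting
  extremality. Since \<open>A\<close> need not be the whole support of \<open>x\<close>, the count
  can be applied to a single period of the nonstationary program.\<close>

lemma vertex_support_card:
  fixes a :: "nat \<Rightarrow> 'k \<Rightarrow> real"
  assumes v: "vertex_of x P" and fin: "finite A" and pos: "\<And>k. k \<in> A \<Longrightarrow> 0 < x k"
    and P: "\<And>d. (\<And>k. k \<notin> A \<Longrightarrow> d k = 0) \<Longrightarrow> (\<And>k. k \<in> A \<Longrightarrow> \<bar>d k\<bar> \<le> x k) \<Longrightarrow> sum d A = 0 \<Longrightarrow>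
              (\<And>i. i < m \<Longrightarrow> (\<Sum>k\<in>A. a i k * d k) = 0) \<Longrightarrow> (\<lambda>k. x k + d k) \<in> P"
  shows "card A \<le> m + 1"
proof (rule ccontr)
  assume "\<not> card A \<le> m + 1"
  \<comment> \<open>Row \<open>m\<close> is the all-ones row, which preserves the total
    probability.\<close>
  define a' where "a' i = (if i = m then (\<lambda>_. 1) else a i)" for i
  obtain d where d: "\<exists>s\<in>A. d s \<noteq> 0" "\<And>i. i < Suc m \<Longrightarrow> (\<Sum>s\<in>A. a' i s * d s) = 0"
    using homogeneous_system_nontrivial_solution[OF fin, of "Suc m" a'] \<open>\<not> card A \<le> m + 1\<close> by auto
  have "\<exists>\<eta>>0. \<forall>s\<in>A. \<bar>\<eta> * d s\<bar> \<le> x s"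
    by (rule scaling_below_positive[OF fin pos])
  then obtain \<eta> where \<eta>: "\<eta> > 0" "\<forall>s\<in>A. \<bar>\<eta> * d s\<bar> \<le> x s"
    by blast
  define e where "e k = (if k \<in> A then \<eta> * d k else 0)" for k
  have sums: "sum e A = 0" "\<And>i. i < m \<Longrightarrow> (\<Sum>k\<in>A. a i k * e k) = 0"
  proof -
    have "sum e A = \<eta> * sum d A" by (simp add: e_def sum_distrib_left)
    with d(2)[of m] show "sum e A = 0" by (simp add: a'_def)
    fix i assume "i < m"
    have "(\<Sum>k\<in>A. a i k * e k) = \<eta> * (\<Sum>k\<in>A. a i k * d k)"
      by (simp add: e_def sum_distrib_left mult_ac)
    with d(2)[of i] \<open>i < m\<close> show "(\<Sum>k\<in>A. a i k * e k) = 0" by (simp add: a'_def)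
  qed
  have out: "e k = 0" if "k \<notin> A" for k using that by (simp add: e_def)
  have le: "\<bar>e k\<bar> \<le> x k" if "k \<in> A" for k using that \<eta>(2) by (simp add: e_def)
  have "(\<lambda>k. x k + e k) \<in> P"
    by (rule P[of e]) (simp_all add: out le sums)
  moreover have "(\<lambda>k. x k + - e k) \<in> P"
    by (rule P[of "\<lambda>k. - e k"]) (simp_all add: out le sums sum_negf)
  ultimately have "e k = 0" for k
    using vertex_of_perturbation[OF v, of e k] by simp
  then have "\<eta> * d k = 0" if "k \<in> A" for k
    using that unfolding e_def by presburger
  with d(1) \<eta>(1) show False by force
qed

section \<open>The linear programs\<close>

lemma SUP_bounds:
  fixes f :: "'b \<Rightarrow> real"
  assumes "A \<noteq> {}" "\<And>x. x \<in> A \<Longrightarrow> 0 \<le> f x" "\<And>x. x \<in> A \<Longrightarrow> f x \<le> c"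
  shows "0 \<le> (SUP x\<in>A. f x)" "(SUP x\<in>A. f x) \<le> c"
proof -
  show "(SUP x\<in>A. f x) \<le> c" using assms by (intro cSUP_least) auto
  obtain x where x: "x \<in> A" using assms by blast
  have "0 \<le> f x" using assms x by blast
  also have "f x \<le> (SUP x\<in>A. f x)" using assms x by (intro cSUP_upper bdd_aboveI2[of _ _ c]) auto
  finally show "0 \<le> (SUP x\<in>A. f x)" .
qed

locale valid =
  fixes M :: model
  assumes valid: "valid_model M"
begin

abbreviation "n \<equiv> num_items M"
abbreviation "T \<equiv> horizon M"
abbreviation "R \<equiv> total_inventory M * p_max M"

section \<open>Consequences of the validity of the model\<close>

lemma inventory_bounds: "i < n \<Longrightarrow> 1 \<le> inventory M i" "i < n \<Longrightarrow> inventory M i \<le> real T"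
  using valid by (auto simp: valid_model_def)

lemma n_pos: "1 \<le> n" and T_pos: "1 \<le> T"
proof -
  show "1 \<le> n" using valid by (auto simp: valid_model_def)
  then show "1 \<le> T" using inventory_bounds[of 0] by auto
qed

lemma assortments_subset: "S \<in> assortments M \<Longrightarrow> S \<subseteq> {..<n} \<times> {..<num_prices M}"
  using valid by (auto simp: valid_model_def)

lemma finite_assortments: "finite (assortments M)"
  by (rule finite_subset[of _ "Pow ({..<n} \<times> {..<num_prices M})"]) (use assortments_subset in auto)

lemma finite_assortment: "S \<in> assortments M \<Longrightarrow> finite S"
  using assortments_subset finite_subset by blast

lemma empty_in_assortments: "{} \<in> assortments M"
  using valid by (auto simp: valid_model_def)

lemma assortments_downward: "S \<in> assortments M \<Longrightarrow> S' \<subseteq> S \<Longrightarrow> S' \<in> assortments M"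
  using valid by (auto simp: valid_model_def)

lemma price_bounds: "j < num_prices M \<Longrightarrow> 0 \<le> price M j" "j < num_prices M \<Longrightarrow> price M j \<le> p_max M"
  using valid by (auto simp: valid_model_def p_max_def less_imp_le intro!: Max_ge)

lemma p_max_pos: "0 < p_max M"
proof -
  have "0 < num_prices M" using valid by (auto simp: valid_model_def)
  then show ?thesis using price_bounds[of 0] valid by (force simp: valid_model_def)
qed

lemma R_pos: "0 < R"
proof -
  have "0 < total_inventory M" unfolding total_inventory_def
    using inventory_bounds n_pos by (intro sum_pos) (auto simp: lessThan_empty_iff intro: less_le_trans[OF zero_less_one])
  with p_max_pos show ?thesis by simp
qed

lemma customer_law:
  assumes "t < T"
  shows prob_space_customer_law: "prob_space (customer_law M t)"
    and demand_measurable: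
      "S \<in> assortments M \<Longrightarrow> (\<lambda>\<theta>. \<theta> S x) \<in> borel_measurable (customer_law M t)"
    and demand_nonneg:
      "S \<in> assortments M \<Longrightarrow> \<theta> \<in> space (customer_law M t) \<Longrightarrow> 0 \<le> \<theta> S x"
    and demand_outside:
      "S \<in> assortments M \<Longrightarrow> \<theta> \<in> space (customer_law M t) \<Longrightarrow> x \<notin> S \<Longrightarrow> \<theta> S x = 0"
    and demand_units_le_1:
      "S \<in> assortments M \<Longrightarrow> \<theta> \<in> space (customer_law M t) \<Longrightarrow> i < n \<Longrightarrow>
        (\<Sum>j<num_prices M. \<theta> S (i, j)) \<le> 1"
proof -
  have "prob_space (customer_law M t) \<and>
        (\<forall>S\<in>assortments M. \<forall>x. (\<lambda>\<theta>. \<theta> S x) \<in> borel_measurable (customer_law M t)) \<and>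
        (\<forall>\<theta>\<in>space (customer_law M t). \<forall>S\<in>assortments M.
           (\<forall>x. 0 \<le> \<theta> S x) \<and> (\<forall>x. x \<notin> S \<longrightarrow> \<theta> S x = 0) \<and>
           (\<forall>i<n. (\<Sum>j<num_prices M. \<theta> S (i, j)) \<le> 1))"
    using valid assms unfolding valid_model_def by (elim conjE) (drule spec[of _ t], erule mp)
  then show "prob_space (customer_law M t)"
    "S \<in> assortments M \<Longrightarrow> (\<lambda>\<theta>. \<theta> S x) \<in> borel_measurable (customer_law M t)"
    "S \<in> assortments M \<Longrightarrow> \<theta> \<in> space (customer_law M t) \<Longrightarrow> 0 \<le> \<theta> S x"
    "S \<in> assortments M \<Longrightarrow> \<theta> \<in> space (customer_law M t) \<Longrightarrow> x \<notin> S \<Longrightarrow> \<theta> S x = 0"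
    "S \<in> assortments M \<Longrightarrow> \<theta> \<in> space (customer_law M t) \<Longrightarrow> i < n \<Longrightarrow>
      (\<Sum>j<num_prices M. \<theta> S (i, j)) \<le> 1"
    by blast+
qed

lemma demand_le_1:
  assumes "t < T" "S \<in> assortments M" "\<theta> \<in> space (customer_law M t)"
  shows "\<theta> S x \<le> 1"
proof (cases "x \<in> S")
  case True
  then obtain i j where x: "x = (i, j)" "i < n" "j < num_prices M"
    using assortments_subset assms by blast
  have "\<theta> S (i, j) \<le> (\<Sum>j<num_prices M. \<theta> S (i, j))"
    using demand_nonneg[OF assms] x by (intro member_le_sum) auto
  with demand_units_le_1[OF assms] x show ?thesis by fastforce
qed (simp add: demand_outside[OF assms])

lemma demand_integrable:
  assumes "t < T" "S \<in> assortments M"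
  shows "integrable (customer_law M t) (\<lambda>\<theta>. \<theta> S x)"
proof -
  interpret prob_space "customer_law M t" using assms prob_space_customer_law by blast
  show ?thesis
    using assms demand_measurable demand_nonneg demand_le_1
    by (intro integrable_const_bound[of _ 1]) (auto simp: abs_le_iff intro: order_trans[of _ 0])
qed

section \<open>Expected demand, usage and reward\<close>

lemma q_nonneg: "t < T \<Longrightarrow> S \<in> assortments M \<Longrightarrow> 0 \<le> q M t S x"
  unfolding q_def using demand_nonneg by (intro Bochner_Integration.integral_nonneg) auto

text \<open>Products outside the assortment have no demand. The sum over all price indices is the
  one that the model bounds by one unit per item.\<close>

lemma usage_eq:
  assumes "t < T" "S \<in> assortments M"
  shows "usage M t i S = (\<Sum>j<num_prices M. q M t S (i, j))"
  unfolding usage_def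
proof (rule sum.mono_neutral_left)
  show "{j. (i, j) \<in> S} \<subseteq> {..<num_prices M}" using assortments_subset assms by blast
  have "q M t S x = 0" if "x \<notin> S" for x
    unfolding q_def using demand_outside[OF assms _ that]
    by (subst Bochner_Integration.integral_cong[OF refl, of _ _ "\<lambda>_. 0"]) auto
  then show "\<forall>j\<in>{..<num_prices M} - {j. (i, j) \<in> S}. q M t S (i, j) = 0" by auto
qed auto

lemma usage_bounds:
  assumes "t < T" "S \<in> assortments M"
  shows "0 \<le> usage M t i S" "i < n \<Longrightarrow> usage M t i S \<le> 1"
proof -
  interpret prob_space "customer_law M t" using assms prob_space_customer_law by blast
  show "0 \<le> usage M t i S" unfolding usage_def using q_nonneg assms by (intro sum_nonneg) auto
  assume "i < n"
  have "usage M t i S = (\<integral>\<theta>. (\<Sum>j<num_prices M. \<theta> S (i, j)) \<partial>customer_law M t)"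
    unfolding usage_eq[OF assms] q_def using demand_integrable assms
    by (subst Bochner_Integration.integral_sum) auto
  also have "\<dots> \<le> (\<integral>\<theta>. 1 \<partial>customer_law M t)"
    using demand_integrable[OF assms] demand_units_le_1[OF assms] \<open>i < n\<close>
    by (intro integral_mono) auto
  finally show "usage M t i S \<le> 1" by (simp add: prob_space)
qed

text \<open>Charging every product at \<open>p_max M\<close> turns the reward into a multiple of the
  usage, which is what the inventory constraints limit.\<close>

lemma reward_bounds:
  assumes "t < T" "S \<in> assortments M"
  shows "0 \<le> reward M t S" "reward M t S \<le> p_max M * (\<Sum>i<n. usage M t i S)"
proof -
  have S: "S \<subseteq> {..<n} \<times> {..<num_prices M}" using assortments_subset assms by blast
  show "0 \<le> reward M t S" unfolding reward_def
    using S q_nonneg[OF assms] price_bounds by (intro sum_nonneg) (auto intro!: mult_nonneg_nonneg)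
  have "reward M t S \<le> (\<Sum>(i, j)\<in>S. p_max M * q M t S (i, j))" unfolding reward_def
    using S q_nonneg[OF assms] price_bounds by (intro sum_mono) (auto intro!: mult_right_mono)
  also have "\<dots> \<le> (\<Sum>(i, j)\<in>{..<n} \<times> {..<num_prices M}. p_max M * q M t S (i, j))"
    using S q_nonneg[OF assms] p_max_pos by (intro sum_mono2) auto
  also have "\<dots> = p_max M * (\<Sum>i<n. usage M t i S)"
    by (subst sum.cartesian_product[symmetric]) (simp add: usage_eq[OF assms] sum_distrib_left)
  finally show "reward M t S \<le> p_max M * (\<Sum>i<n. usage M t i S)" .
qed

section \<open>Bounds on the values of the linear programs\<close>

lemma cdlp_S_value_bounds:
  assumes "x \<in> cdlp_S_feasible M"
  shows "0 \<le> cdlp_S_value M x" "cdlp_S_value M x \<le> R"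
proof -
  have x: "\<And>S. 0 \<le> x S"
    "\<And>i. i < n \<Longrightarrow> real T * (\<Sum>S\<in>assortments M. x S * usage M 0 i S) \<le> inventory M i"
    using assms by (auto simp: cdlp_S_feasible_def)
  have T: "0 < T" using T_pos by simp
  show "0 \<le> cdlp_S_value M x" unfolding cdlp_S_value_def
    using x reward_bounds T by (intro mult_nonneg_nonneg sum_nonneg) auto
  have "cdlp_S_value M x \<le> real T * (\<Sum>S\<in>assortments M. x S * (p_max M * (\<Sum>i<n. usage M 0 i S)))"
    unfolding cdlp_S_value_def
    using x reward_bounds T by (intro mult_left_mono sum_mono) auto
  \<comment> \<open>Exchanging the sums isolates the total usage of each item, to which its
    inventory constraint applies.\<close>
  also have "\<dots> = p_max M * (\<Sum>i<n. real T * (\<Sum>S\<in>assortments M. x S * usage M 0 i S))"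
    by (simp add: sum_distrib_left mult_ac) (rule sum.swap)
  also have "\<dots> \<le> p_max M * (\<Sum>i<n. inventory M i)"
    using x(2) p_max_pos by (intro mult_left_mono sum_mono) auto
  finally show "cdlp_S_value M x \<le> R" by (simp add: total_inventory_def mult.commute)
qed

lemma cdlp_N_value_bounds:
  assumes "x \<in> cdlp_N_feasible M"
  shows "0 \<le> cdlp_N_value M x" "cdlp_N_value M x \<le> R"
proof -
  have x: "\<And>t S. 0 \<le> x (t, S)"
    "\<And>i. i < n \<Longrightarrow> (\<Sum>t<T. \<Sum>S\<in>assortments M. x (t, S) * usage M t i S) \<le> inventory M i"
    using assms by (auto simp: cdlp_N_feasible_def)
  show "0 \<le> cdlp_N_value M x" unfolding cdlp_N_value_def
    using x reward_bounds by (intro sum_nonneg) auto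
  have "cdlp_N_value M x
      \<le> (\<Sum>t<T. \<Sum>S\<in>assortments M. x (t, S) * (p_max M * (\<Sum>i<n. usage M t i S)))"
    unfolding cdlp_N_value_def
    using x reward_bounds by (intro mult_left_mono sum_mono) auto
  also have "\<dots> = (\<Sum>t<T. \<Sum>S\<in>assortments M. \<Sum>i<n. p_max M * (x (t, S) * usage M t i S))"
    by (simp add: sum_distrib_left mult_ac)
  also have "\<dots> = (\<Sum>t<T. \<Sum>i<n. \<Sum>S\<in>assortments M. p_max M * (x (t, S) * usage M t i S))"
    by (intro sum.cong refl sum.swap)
  also have "\<dots> = (\<Sum>i<n. \<Sum>t<T. \<Sum>S\<in>assortments M. p_max M * (x (t, S) * usage M t i S))"
    by (rule sum.swap)
  also have "\<dots> = p_max M * (\<Sum>i<n. \<Sum>t<T. \<Sum>S\<in>assortments M. x (t, S) * usage M t i S)"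
    by (simp add: sum_distrib_left)
  also have "\<dots> \<le> p_max M * (\<Sum>i<n. inventory M i)"
    using x(2) p_max_pos by (intro mult_left_mono sum_mono) auto
  finally show "cdlp_N_value M x \<le> R" by (simp add: total_inventory_def mult.commute)
qed

lemma cdlp_S_feasible_nonempty: "cdlp_S_feasible M \<noteq> {}"
proof -
  have "(\<lambda>S. if S = {} then 1 else 0) \<in> cdlp_S_feasible M"
    using finite_assortments empty_in_assortments inventory_bounds
    by (auto simp: cdlp_S_feasible_def if_distrib[of "\<lambda>y. y * _"] usage_def
        intro: order_trans[of 0 1] cong: if_cong)
  then show ?thesis by blast
qed

lemma cdlp_N_feasible_nonempty: "cdlp_N_feasible M \<noteq> {}"
proof -
  have "(\<lambda>(t, S). if t < T \<and> S = {} then 1 else 0) \<in> cdlp_N_feasible M"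
    using finite_assortments empty_in_assortments inventory_bounds
    by (auto simp: cdlp_N_feasible_def if_distrib[of "\<lambda>y. y * _"] usage_def
        intro: order_trans[of 0 1] cong: if_cong)
  then show ?thesis by blast
qed

text \<open>Nonnegativity leaves \<open>opt_lp M = 0\<close> as the only degenerate case of the
  revenue guarantee. The upper bound makes \<open>R\<^sup>2 / (opt_lp M)\<^sup>2\<close> at least 1
  when \<open>opt_lp M\<close> is positive, which the time bound relies on.\<close>

lemma opt_lp_bounds: "0 \<le> opt_lp M" "opt_lp M \<le> R"
  unfolding opt_lp_def
  using SUP_bounds[OF cdlp_S_feasible_nonempty cdlp_S_value_bounds]
    SUP_bounds[OF cdlp_N_feasible_nonempty cdlp_N_value_bounds] by auto

section \<open>Supports of LP vertices and of the policies built from them\<close>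

text \<open>If \<open>n = T = 1\<close> the inventory constraint is implied by the others, so it does not count.\<close>

definition num_constraints :: nat where
  "num_constraints = (if n * T = 1 then 0 else n)"

text \<open>One period uses at most one expected unit of an item, and at least one unit is in
  stock.\<close>

lemma usage_single_item:
  assumes "n * T = 1" "i < n" "t < T" "\<And>S. 0 \<le> x S" "(\<Sum>S\<in>assortments M. x S) = 1"
  shows "(\<Sum>S\<in>assortments M. x S * usage M t i S) \<le> inventory M i"
proof -
  have "(\<Sum>S\<in>assortments M. x S * usage M t i S) \<le> (\<Sum>S\<in>assortments M. x S * 1)"
    using assms usage_bounds by (intro sum_mono mult_left_mono) auto
  also have "\<dots> \<le> inventory M i" using assms inventory_bounds by simp
  finally show ?thesis .
qed

text \<open>A perturbation within the support that preserves the total mass and the counted usages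
  stays feasible, so the count for vertices applies with \<open>num_constraints\<close>
  rows.\<close>

lemma cdlp_S_vertex_support:
  assumes "vertex_of x (cdlp_S_feasible M)"
  shows "card {S. x S \<noteq> 0} \<le> num_constraints + 1"
proof (rule vertex_support_card[OF assms, where a = "usage M 0"])
  have feas: "x \<in> cdlp_S_feasible M" using assms by (simp add: vertex_of_def)
  then have x: "\<And>S. 0 \<le> x S" "\<And>S. S \<notin> assortments M \<Longrightarrow> x S = 0" "(\<Sum>S\<in>assortments M. x S) = 1"
    "\<And>i. i < n \<Longrightarrow> real T * (\<Sum>S\<in>assortments M. x S * usage M 0 i S) \<le> inventory M i"
    by (auto simp: cdlp_S_feasible_def)
  have sub: "{S. x S \<noteq> 0} \<subseteq> assortments M" using x by blast
  then show "finite {S. x S \<noteq> 0}" using finite_assortments finite_subset by blast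
  show "\<And>S. S \<in> {S. x S \<noteq> 0} \<Longrightarrow> 0 < x S" using x by (auto simp: less_le)
  fix d :: "assortment \<Rightarrow> real"
  assume d: "\<And>S. S \<notin> {S. x S \<noteq> 0} \<Longrightarrow> d S = 0" "\<And>S. S \<in> {S. x S \<noteq> 0} \<Longrightarrow> \<bar>d S\<bar> \<le> x S"
    "sum d {S. x S \<noteq> 0} = 0"
    "\<And>i. i < num_constraints \<Longrightarrow> (\<Sum>S\<in>{S. x S \<noteq> 0}. usage M 0 i S * d S) = 0"
  have "sum d (assortments M) = sum d {S. x S \<noteq> 0}"
    using sub d(1) finite_assortments by (intro sum.mono_neutral_right) auto
  then have one: "(\<Sum>S\<in>assortments M. x S + d S) = 1" using d(3) x(3) by (simp add: sum.distrib)
  have nonneg: "0 \<le> x S + d S" for S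
    using d(1)[of S] d(2)[of S] x(1)[of S] by (cases "x S = 0") (auto simp: abs_le_iff)
  have inv: "real T * (\<Sum>S\<in>assortments M. (x S + d S) * usage M 0 i S) \<le> inventory M i" if i: "i < n" for i
  proof (cases "n * T = 1")
    case True
    with usage_single_item[OF True i, of 0 "\<lambda>S. x S + d S"] one nonneg show ?thesis by simp
  next
    case False
    have "(\<Sum>S\<in>assortments M. d S * usage M 0 i S) = (\<Sum>S\<in>{S. x S \<noteq> 0}. usage M 0 i S * d S)"
      using sub d(1) finite_assortments by (intro sum.mono_neutral_cong_right) auto
    also have "\<dots> = 0" using d(4)[of i] i False unfolding num_constraints_def by presburger
    finally show ?thesis using x(4)[OF i] by (simp add: sum.distrib distrib_right)
  qed
  show "(\<lambda>S. x S + d S) \<in> cdlp_S_feasible M"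
    using one nonneg inv x d(1) by (auto simp: cdlp_S_feasible_def)
qed

text \<open>Only period \<open>t\<close> is perturbed. The normalizations of the other periods are
  untouched, so the bound for each period involves one normalization and the inventory rows,
  independently of the number of periods.\<close>

lemma cdlp_N_vertex_support:
  assumes "vertex_of x (cdlp_N_feasible M)" and t: "t < T"
  shows "card {S. x (t, S) \<noteq> 0} \<le> num_constraints + 1"
proof -
  define A where "A = {t} \<times> {S. x (t, S) \<noteq> 0}"
  have feas: "x \<in> cdlp_N_feasible M" using assms by (simp add: vertex_of_def)
  then have x: "\<And>t S. 0 \<le> x (t, S)" "\<And>t S. \<not> (t < T \<and> S \<in> assortments M) \<Longrightarrow> x (t, S) = 0"
    "\<And>t. t < T \<Longrightarrow> (\<Sum>S\<in>assortments M. x (t, S)) = 1"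
    "\<And>i. i < n \<Longrightarrow> (\<Sum>t<T. \<Sum>S\<in>assortments M. x (t, S) * usage M t i S) \<le> inventory M i"
    by (auto simp: cdlp_N_feasible_def)
  have sub: "{S. x (t, S) \<noteq> 0} \<subseteq> assortments M" using x by blast
  have A: "A \<subseteq> {..<T} \<times> assortments M" using sub t by (auto simp: A_def)
  have "card A \<le> num_constraints + 1"
  proof (rule vertex_support_card[OF assms(1), where a = "\<lambda>i (t, S). usage M t i S"])
    show "finite A" using A finite_assortments finite_subset by blast
    show "\<And>k. k \<in> A \<Longrightarrow> 0 < x k" using x(1) by (auto simp: less_le A_def)
    fix d :: "nat \<times> assortment \<Rightarrow> real"
    assume d: "\<And>k. k \<notin> A \<Longrightarrow> d k = 0" "\<And>k. k \<in> A \<Longrightarrow> \<bar>d k\<bar> \<le> x k" "sum d A = 0"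
      "\<And>i. i < num_constraints \<Longrightarrow> (\<Sum>k\<in>A. (case k of (t, S) \<Rightarrow> usage M t i S) * d k) = 0"
    have "(\<Sum>S\<in>assortments M. d (s, S)) = 0" for s
    proof (cases "s = t")
      case True
      have "sum d A = sum (\<lambda>S. d (t, S)) {S. x (t, S) \<noteq> 0}"
        unfolding A_def by (subst sum.cartesian_product') simp
      also have "\<dots> = (\<Sum>S\<in>assortments M. d (t, S))"
        using sub d(1) finite_assortments by (intro sum.mono_neutral_left) (auto simp: A_def)
      finally show ?thesis using d(3) True by simp
    qed (use d(1) in \<open>auto simp: A_def\<close>)
    then have one: "(\<Sum>S\<in>assortments M. x (s, S) + d (s, S)) = 1" if "s < T" for s
      using x(3)[OF that] by (simp add: sum.distrib)
    have nonneg: "0 \<le> x (s, S) + d (s, S)" for s S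
      using d(1)[of "(s, S)"] d(2)[of "(s, S)"] x(1)[of s S]
      by (cases "(s, S) \<in> A") (auto simp: abs_le_iff)
    have inv: "(\<Sum>t<T. \<Sum>S\<in>assortments M. (x (t, S) + d (t, S)) * usage M t i S) \<le> inventory M i"
      if i: "i < n" for i
    proof (cases "n * T = 1")
      case True
      then have "T = 1" by simp
      with usage_single_item[OF True i, of 0 "\<lambda>S. x (0, S) + d (0, S)"] one nonneg show ?thesis by simp
    next
      case False
      have "(\<Sum>s<T. \<Sum>S\<in>assortments M. d (s, S) * usage M s i S)
          = (\<Sum>(s, S)\<in>{..<T} \<times> assortments M. d (s, S) * usage M s i S)"
        by (simp add: sum.cartesian_product)
      also have "\<dots> = (\<Sum>k\<in>A. (case k of (t, S) \<Rightarrow> usage M t i S) * d k)"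
        using A d(1) finite_assortments by (intro sum.mono_neutral_cong_right) auto
      also have "\<dots> = 0" using d(4)[of i] i False unfolding num_constraints_def by presburger
      finally show ?thesis using x(4)[OF i] by (simp add: sum.distrib distrib_right)
    qed
    have "x (s, S) + d (s, S) = 0" if "\<not> (s < T \<and> S \<in> assortments M)" for s S
    proof -
      have "(s, S) \<notin> A" using A that by blast
      with d(1) x(2)[OF that] show ?thesis by simp
    qed
    then show "(\<lambda>k. x k + d k) \<in> cdlp_N_feasible M"
      using one nonneg inv by (auto simp: cdlp_N_feasible_def)
  qed
  then show ?thesis by (simp add: A_def card_cartesian_product_singleton)
qed

text \<open>Under this condition the restriction to \<open>assortments M\<close> in
  \<open>sim_space\<close> loses no probability mass.\<close>

definition admissible :: "policy \<Rightarrow> bool" where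
  "admissible z \<longleftrightarrow> (\<forall>t<T. set_pmf (z t) \<subseteq> assortments M)"

text \<open>Algorithm 2 takes an image of the support of a vertex, which cannot be larger and stays
  in the family by downward closure; Algorithm 3 adds at most the empty assortment. The sharp value
  1 for \<open>n = T = 1\<close> is essential, because then no runs are made and estimates carry no
  information.\<close>

lemma algorithm_support:
  assumes "algorithm1 M z \<or> algorithm2 M z \<or> algorithm3 M z"
  shows "admissible z" "t < T \<Longrightarrow> card (set_pmf (z t)) \<le> (if n * T = 1 then 1 else n + 2)"
proof -
  have "set_pmf (z t) \<subseteq> assortments M \<and> card (set_pmf (z t)) \<le> (if n * T = 1 then 1 else n + 2)"
    if t: "t < T" for t
    using assms
  proof (elim disjE)
    assume "algorithm1 M z"
    then obtain x where x: "vertex_of x (cdlp_S_feasible M)" "\<And>S. pmf (z t) S = x S"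
      using t by (auto simp: algorithm1_def optimal_vertex_def)
    then have "set_pmf (z t) = {S. x S \<noteq> 0}" by (auto simp: set_pmf_eq)
    moreover have "{S. x S \<noteq> 0} \<subseteq> assortments M"
      using x by (auto simp: vertex_of_def cdlp_S_feasible_def)
    ultimately show ?thesis
      using cdlp_S_vertex_support[OF x(1)] by (auto simp: num_constraints_def)
  next
    assume "algorithm2 M z"
    then obtain x y where x: "vertex_of x (cdlp_N_feasible M)" "\<And>S. pmf (y t) S = x (t, S)"
        and z: "z t = map_pmf (discard_cheap M x) (y t)"
      using t unfolding algorithm2_def optimal_vertex_def by blast
    then have y: "set_pmf (y t) = {S. x (t, S) \<noteq> 0}" by (auto simp: set_pmf_eq)
    have sub: "{S. x (t, S) \<noteq> 0} \<subseteq> assortments M"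
      using x by (auto simp: vertex_of_def cdlp_N_feasible_def)
    have "card (set_pmf (z t)) \<le> card {S. x (t, S) \<noteq> 0}" unfolding z set_map_pmf y
      using finite_subset[OF sub finite_assortments] by (rule card_image_le)
    moreover have "discard_cheap M x S \<subseteq> S" for S by (auto simp: discard_cheap_def)
    then have "set_pmf (z t) \<subseteq> assortments M"
      using sub assortments_downward unfolding z set_map_pmf y by blast
    ultimately show ?thesis
      using cdlp_N_vertex_support[OF x(1) t] by (auto simp: num_constraints_def)
  next
    assume "algorithm3 M z"
    then obtain x where x: "vertex_of x (cdlp_N_feasible M)"
        and z: "\<And>S. pmf (z t) S = (1 - delta M) * x (t, S) + (if S = {} then delta M else 0)"
      using t unfolding algorithm3_def optimal_vertex_def by blast
    have sub: "{S. x (t, S) \<noteq> 0} \<subseteq> assortments M"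
      using x by (auto simp: vertex_of_def cdlp_N_feasible_def)
    then have fin: "finite {S. x (t, S) \<noteq> 0}" using finite_assortments finite_subset by blast
    have 1: "set_pmf (z t) \<subseteq> insert {} {S. x (t, S) \<noteq> 0}" by (auto simp: set_pmf_eq z)
    show ?thesis
    proof (cases "n * T = 1")
      case True
      then have nT: "n = 1" "T = 1" by auto
      \<comment> \<open>The inventory lies between 1 and \<open>T = 1\<close>. Then
        \<open>ln 1 = 0\<close> makes \<open>delta M\<close> vanish, and the empty assortment is not
        added.\<close>
      have "inventory M 0 = 1" using inventory_bounds[of 0] nT by simp
      then have "min_inventory M = 1" by (simp add: min_inventory_def nT lessThan_Suc)
      then have "delta M = 0" by (simp add: delta_def)
      then have "set_pmf (z t) = {S. x (t, S) \<noteq> 0}" by (auto simp: set_pmf_eq z)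
      then show ?thesis
        using cdlp_N_vertex_support[OF x(1) t] sub True by (simp add: num_constraints_def)
    next
      case False
      have "card (set_pmf (z t)) \<le> card (insert {} {S. x (t, S) \<noteq> 0})"
        using 1 fin by (intro card_mono) auto
      also have "\<dots> \<le> Suc (card {S. x (t, S) \<noteq> 0})" using fin by (simp add: card_insert_if)
      also have "\<dots> \<le> n + 2"
        using cdlp_N_vertex_support[OF x(1) t] False unfolding num_constraints_def by presburger
      finally show ?thesis using 1 sub False empty_in_assortments by auto
    qed
  qed
  then show "admissible z" "t < T \<Longrightarrow> card (set_pmf (z t)) \<le> (if n * T = 1 then 1 else n + 2)"
    by (auto simp: admissible_def)
qed

end

section \<open>The simulator\<close>

context valid
begin

abbreviation period_space :: "policy \<Rightarrow> nat \<Rightarrow> (assortment \<times> customer) measure" where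
  "period_space z t \<equiv> restrict_space (measure_pmf (z t)) (assortments M) \<Otimes>\<^sub>M customer_law M t"

lemma faced_in_assortments: "S \<in> assortments M \<Longrightarrow> faced M c S \<in> assortments M"
  by (auto simp: faced_def split: substitution.splits elim!: assortments_downward)

section \<open>The probability space of a simulator run\<close>

lemma sets_restrict_pmf:
  "sets (restrict_space (measure_pmf p) (assortments M)) = sets (count_space (assortments M))"
  by (auto simp: sets_restrict_space)

lemma prob_space_restrict_pmf:
  "set_pmf p \<subseteq> assortments M \<Longrightarrow> prob_space (restrict_space (measure_pmf p) (assortments M))"
  by (intro prob_space_restrict_space measure_pmf.emeasure_eq_1_AE) (auto simp: AE_measure_pmf_iff)

lemma prob_space_period:
  assumes "admissible z" "t < T"
  shows "prob_space (period_space z t)"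
proof -
  interpret A: prob_space "restrict_space (measure_pmf (z t)) (assortments M)"
    using assms by (intro prob_space_restrict_pmf) (auto simp: admissible_def)
  interpret B: prob_space "customer_law M t" using assms prob_space_customer_law by blast
  interpret pair_prob_space "restrict_space (measure_pmf (z t)) (assortments M)" "customer_law M t" ..
  show ?thesis by (rule prob_space_axioms)
qed

lemma prob_space_sim_space:
  assumes "admissible z"
  shows "prob_space (sim_space M z)"
  unfolding sim_space_def using prob_space_period[OF assms] by (intro prob_space_PiM) auto

lemma space_sim_spaceD:
  assumes "\<omega> \<in> space (sim_space M z)" "t < T"
  shows "fst (\<omega> t) \<in> assortments M" "snd (\<omega> t) \<in> space (customer_law M t)"
proof -
  have "\<omega> t \<in> assortments M \<times> space (customer_law M t)"
    using assms by (auto simp: sim_space_def space_PiM PiE_iff space_pair_measure space_restrict_space)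
  then show "fst (\<omega> t) \<in> assortments M" "snd (\<omega> t) \<in> space (customer_law M t)" by auto
qed

lemma period_measurable: "t < T \<Longrightarrow> (\<lambda>\<omega>. \<omega> t) \<in> measurable (sim_space M z) (period_space z t)"
  unfolding sim_space_def by (intro measurable_component_singleton) auto

lemma shown_measurable:
  assumes "t < T"
  shows "(\<lambda>\<omega>. fst (\<omega> t)) \<in> measurable (sim_space M z) (count_space (assortments M))"
proof -
  have "(\<lambda>\<omega>. fst (\<omega> t))
      \<in> measurable (sim_space M z) (restrict_space (measure_pmf (z t)) (assortments M))"
    by (rule measurable_compose[OF period_measurable[OF assms] measurable_fst])
  then show ?thesis by (simp only: measurable_cong_sets[OF refl sets_restrict_pmf])
qed

lemma customer_measurable:
  assumes "t < T"
  shows "(\<lambda>\<omega>. snd (\<omega> t)) \<in> measurable (sim_space M z) (customer_law M t)"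
  by (rule measurable_compose[OF period_measurable[OF assms] measurable_snd])

section \<open>Measurability of the simulated revenue\<close>

text \<open>Under dynamic substitution the faced set is determined by finitely many events
  \<open>0 < c \<omega> i\<close>, one for each product of \<open>S\<close>.\<close>

lemma faced_eq_measurable:
  assumes c: "\<And>i. (\<lambda>\<omega>. c \<omega> i) \<in> borel_measurable N" and S: "S \<in> assortments M"
  shows "{\<omega> \<in> space N. faced M (c \<omega>) S = A} \<in> sets N"
proof (cases "substitution M")
  case Static
  then show ?thesis by (simp add: faced_def)
next
  case Dynamic
  note [measurable] = c
  have "finite S" using S finite_assortment by blast
  have "faced M (c \<omega>) S = A \<longleftrightarrow> A \<subseteq> S \<and> (\<forall>x\<in>S. (0 < c \<omega> (fst x)) = (x \<in> A))" for \<omega>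
    using Dynamic unfolding faced_def by fastforce
  then have "{\<omega> \<in> space N. faced M (c \<omega>) S = A}
      = {\<omega> \<in> space N. A \<subseteq> S \<and> (\<forall>x\<in>S. (0 < c \<omega> (fst x)) = (x \<in> A))}"
    by simp
  also have "\<dots> \<in> sets N"
    using \<open>finite S\<close> by (intro sets.sets_Collect_conj sets.sets_Collect_finite_All) auto
  finally show ?thesis .
qed

text \<open>The table is read at a random assortment. Splitting over the finitely many values
  \<open>S\<close> of the shown and \<open>A\<close> of the faced assortment leaves only entries at
  fixed assortments, whose measurability the model provides.\<close>

lemma faced_demand_measurable:
  assumes t: "t < T" and c: "\<And>i. (\<lambda>\<omega>. c \<omega> i) \<in> borel_measurable (sim_space M z)"
  shows "(\<lambda>\<omega>. snd (\<omega> t) (faced M (c \<omega>) (fst (\<omega> t))) x) \<in> borel_measurable (sim_space M z)"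
    (is "?f \<in> borel_measurable ?N")
proof -
  have "?f \<omega> = (\<Sum>S\<in>assortments M. \<Sum>A\<in>assortments M.
      if fst (\<omega> t) = S \<and> faced M (c \<omega>) S = A then snd (\<omega> t) A x else 0)"
    if "\<omega> \<in> space ?N" for \<omega>
  proof -
    have *: "fst (\<omega> t) \<in> assortments M" using space_sim_spaceD that t by blast
    have "(\<Sum>S\<in>assortments M. \<Sum>A\<in>assortments M.
        if fst (\<omega> t) = S \<and> faced M (c \<omega>) S = A then snd (\<omega> t) A x else 0)
      = (\<Sum>S\<in>assortments M. if S = fst (\<omega> t) then \<Sum>A\<in>assortments M.
        if A = faced M (c \<omega>) (fst (\<omega> t)) then snd (\<omega> t) A x else 0 else 0)"
      by (intro sum.cong) (auto intro!: sum.cong)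
    also have "\<dots> = ?f \<omega>"
      using * faced_in_assortments[OF *] finite_assortments by simp
    finally show ?thesis by simp
  qed
  moreover have "(\<lambda>\<omega>. \<Sum>S\<in>assortments M. \<Sum>A\<in>assortments M.
      if fst (\<omega> t) = S \<and> faced M (c \<omega>) S = A then snd (\<omega> t) A x else 0) \<in> borel_measurable ?N"
  proof (intro borel_measurable_sum measurable_If)
    fix S A assume SA: "S \<in> assortments M" "A \<in> assortments M"
    show "(\<lambda>\<omega>. snd (\<omega> t) A x) \<in> borel_measurable ?N"
      using measurable_compose[OF customer_measurable[OF t] demand_measurable[OF t SA(2)]] .
    have "(\<lambda>\<omega>. fst (\<omega> t)) -` {S} \<inter> space ?N \<in> sets ?N"
      using SA by (intro measurable_sets[OF shown_measurable[OF t]]) auto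
    moreover have "(\<lambda>\<omega>. fst (\<omega> t)) -` {S} \<inter> space ?N = {\<omega> \<in> space ?N. fst (\<omega> t) = S}" by auto
    ultimately show "{\<omega> \<in> space ?N. fst (\<omega> t) = S \<and> faced M (c \<omega>) S = A} \<in> sets ?N"
      using faced_eq_measurable[OF c SA(1)] by (intro sets.sets_Collect_conj) auto
  qed auto
  ultimately show ?thesis by (subst measurable_cong) auto
qed

lemma simulate_measurable:
  assumes "t \<le> T"
  shows "(\<lambda>\<omega>. fst (simulate M z' \<omega> t) i) \<in> borel_measurable (sim_space M z)"
    and "(\<lambda>\<omega>. fst (snd (simulate M z' \<omega> t))) \<in> borel_measurable (sim_space M z)"
proof -
  have "(\<forall>i. (\<lambda>\<omega>. fst (simulate M z' \<omega> t) i) \<in> borel_measurable (sim_space M z)) \<and>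
    (\<lambda>\<omega>. fst (snd (simulate M z' \<omega> t))) \<in> borel_measurable (sim_space M z)"
    using assms
  proof (induction t)
    case (Suc t)
    then have [measurable]: "\<And>i. (\<lambda>\<omega>. fst (simulate M z' \<omega> t) i) \<in> borel_measurable (sim_space M z)"
      "(\<lambda>\<omega>. fst (snd (simulate M z' \<omega> t))) \<in> borel_measurable (sim_space M z)"
      by auto
    have [measurable]:
      "(\<lambda>\<omega>. snd (\<omega> t) (faced M (fst (simulate M z' \<omega> t)) (fst (\<omega> t))) x)
        \<in> borel_measurable (sim_space M z)" for x
      using Suc.prems by (intro faced_demand_measurable) auto
    show ?case
      by (simp add: sim_step_def case_prod_beta Let_def units_def spend_def)
  qed simp
  then show "(\<lambda>\<omega>. fst (simulate M z' \<omega> t) i) \<in> borel_measurable (sim_space M z)"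
    and "(\<lambda>\<omega>. fst (snd (simulate M z' \<omega> t))) \<in> borel_measurable (sim_space M z)"
    by auto
qed

lemma sim_revenue_measurable: "sim_revenue M z' \<in> borel_measurable (sim_space M z)"
  using simulate_measurable(2)[of T] by (simp add: sim_revenue_def[abs_def])

text \<open>The policy argument enters only the operation counter; the assortments shown are read
  from \<open>\<omega>\<close>. Pinning a period thus changes the measure but not the
  integrand.\<close>

lemma sim_revenue_policy: "sim_revenue M z \<omega> = sim_revenue M z' \<omega>"
proof -
  have "fst (simulate M z \<omega> t) = fst (simulate M z' \<omega> t) \<and>
      fst (snd (simulate M z \<omega> t)) = fst (snd (simulate M z' \<omega> t))" for t
    by (induction t) (simp_all add: sim_step_def case_prod_beta Let_def)
  then show ?thesis by (simp add: sim_revenue_def)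
qed

text \<open>The operations of a step do not depend on the outcome, so the cost of a run is
  deterministic.\<close>

lemma sim_ops_eq:
  "sim_ops M z \<omega> = n + (\<Sum>t<T. 2 + 2 * card (set_pmf (z t)) + 8 * n)"
proof -
  have "snd (snd (simulate M z \<omega> t)) = n + (\<Sum>t<t. 2 + 2 * card (set_pmf (z t)) + 8 * n)" for t
    by (induction t) (simp_all add: sim_step_def case_prod_beta Let_def)
  then show ?thesis by (simp add: sim_ops_def)
qed

section \<open>Range and integrability of the revenue\<close>

text \<open>Revenue is charged against the stock sold, each unit of which brings at most \<open>p_max\<close>.\<close>

lemma simulate_invariant:
  assumes \<omega>: "\<And>t. t < T \<Longrightarrow> fst (\<omega> t) \<in> assortments M"
      "\<And>t. t < T \<Longrightarrow> snd (\<omega> t) \<in> space (customer_law M t)" and "t \<le> T"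
  shows "(\<forall>i<n. 0 \<le> fst (simulate M z \<omega> t) i) \<and> 0 \<le> fst (snd (simulate M z \<omega> t)) \<and>
    fst (snd (simulate M z \<omega> t)) + p_max M * (\<Sum>i<n. fst (simulate M z \<omega> t) i) \<le> R"
  using \<open>t \<le> T\<close>
proof (induction t)
  case 0
  show ?case using inventory_bounds by (force simp: total_inventory_def mult.commute)
next
  case (Suc t)
  then have t: "t < T" by simp
  define c where "c = fst (simulate M z \<omega> t)"
  define r where "r = fst (snd (simulate M z \<omega> t))"
  define d where "d = snd (\<omega> t) (faced M c (fst (\<omega> t)))"
  define f where "f i = min 1 (c i / units M d i)" for i
  have IH: "\<And>i. i < n \<Longrightarrow> 0 \<le> c i" "0 \<le> r" "r + p_max M * (\<Sum>i<n. c i) \<le> R"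
    using Suc by (auto simp: c_def r_def)
  have step: "fst (simulate M z \<omega> (Suc t)) = (\<lambda>i. c i - units M d i * f i)"
    "fst (snd (simulate M z \<omega> (Suc t))) = r + (\<Sum>i<n. spend M d i * f i)"
    by (simp_all add: sim_step_def case_prod_beta Let_def c_def r_def d_def f_def[abs_def])
  have d: "0 \<le> d x" for x
    unfolding d_def using t \<omega> faced_in_assortments by (intro demand_nonneg) auto
  have u: "0 \<le> units M d i" for i unfolding units_def using d by (intro sum_nonneg) auto
  have f: "0 \<le> f i" "units M d i * f i \<le> c i" if "i < n" for i
  proof -
    show "0 \<le> f i" using u IH(1)[OF that] by (simp add: f_def)
    show "units M d i * f i \<le> c i"
    proof (cases "units M d i = 0")
      case False
      have "units M d i * f i \<le> units M d i * (c i / units M d i)"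
        using u by (intro mult_left_mono) (auto simp: f_def)
      then show ?thesis using False by simp
    qed (use IH(1)[OF that] in simp)
  qed
  have s: "0 \<le> spend M d i" "spend M d i \<le> p_max M * units M d i" for i
    unfolding spend_def units_def sum_distrib_left
    using d price_bounds by (auto intro!: sum_nonneg sum_mono mult_right_mono)
  have "(\<Sum>i<n. spend M d i * f i) \<le> (\<Sum>i<n. p_max M * units M d i * f i)"
    using s f by (intro sum_mono mult_right_mono) auto
  also have "\<dots> = p_max M * (\<Sum>i<n. units M d i * f i)" by (simp add: sum_distrib_left mult_ac)
  finally have "(\<Sum>i<n. spend M d i * f i) \<le> p_max M * (\<Sum>i<n. units M d i * f i)" .
  moreover have "0 \<le> (\<Sum>i<n. spend M d i * f i)" using s f by (intro sum_nonneg) auto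
  ultimately show ?case
    unfolding step using IH f by (auto simp: sum_subtractf right_diff_distrib)
qed

lemma sim_revenue_bounds:
  assumes "\<omega> \<in> space (sim_space M z)"
  shows "0 \<le> sim_revenue M z' \<omega>" "sim_revenue M z' \<omega> \<le> R"
proof -
  note inv = simulate_invariant[of \<omega> T z', OF space_sim_spaceD[OF assms] order_refl]
  from inv show "0 \<le> sim_revenue M z' \<omega>" by (simp add: sim_revenue_def)
  have "0 \<le> p_max M * (\<Sum>i<n. fst (simulate M z' \<omega> T) i)"
    using inv p_max_pos by (intro mult_nonneg_nonneg sum_nonneg) auto
  with inv show "sim_revenue M z' \<omega> \<le> R" by (simp add: sim_revenue_def)
qed

lemma sim_revenue_integrable:
  assumes "admissible z"
  shows "integrable (sim_space M z) (sim_revenue M z')"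
proof -
  interpret prob_space "sim_space M z" by (rule prob_space_sim_space[OF assms])
  show ?thesis
    using sim_revenue_bounds sim_revenue_measurable
    by (intro integrable_const_bound[of _ R] AE_I2) auto
qed

text \<open>With nonnegative integrals the periods can be separated by Tonelli's theorem without
  integrability conditions. The free \<open>z'\<close> allows one fixed integrand for several
  policies.\<close>

lemma ennreal_expected_revenue:
  assumes "admissible z"
  shows "ennreal (expected_revenue M z) = (\<integral>\<^sup>+\<omega>. ennreal (sim_revenue M z' \<omega>) \<partial>sim_space M z)"
  unfolding expected_revenue_def sim_revenue_policy[of z _ z']
  using sim_revenue_integrable[OF assms] sim_revenue_bounds
  by (intro nn_integral_eq_integral[symmetric]) auto

lemma expected_revenue_nonneg: "0 \<le> expected_revenue M z"
  unfolding expected_revenue_def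
  using sim_revenue_bounds by (intro Bochner_Integration.integral_nonneg) auto

lemma expected_revenue_cong:
  assumes "\<And>t. t < T \<Longrightarrow> z t = z' t"
  shows "expected_revenue M z = expected_revenue M z'"
proof -
  have "sim_space M z = sim_space M z'"
    unfolding sim_space_def using assms by (intro PiM_cong) auto
  moreover have "sim_revenue M z = sim_revenue M z'" using sim_revenue_policy by blast
  ultimately show ?thesis by (simp add: expected_revenue_def)
qed

section \<open>Conditioning on the assortment of one period\<close>

lemma admissible_update: "admissible z \<Longrightarrow> S \<in> assortments M \<Longrightarrow> admissible (z(t := return_pmf S))"
  by (simp add: admissible_def)

text \<open>Law of total expectation. Tonelli's theorem splits off period \<open>t\<close>, then its
  assortment from its customer; the inner integral \<open>G S\<close> depends only on the other
  periods and on the customer of period \<open>t\<close>.\<close>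

lemma expected_revenue_condition_period:
  assumes z: "admissible z" and t: "t < T"
  shows "expected_revenue M z
    = (\<Sum>S\<in>set_pmf (z t). pmf (z t) S * expected_revenue M (z(t := return_pmf S)))"
proof -
  let ?f = "\<lambda>\<omega>. ennreal (sim_revenue M z \<omega>)"
  let ?J = "{..<T} - {t}"
  \<comment> \<open>A point mass beyond the horizon makes every factor a probability space, as the
    product locale demands for all indices.\<close>
  define L where "L y s = (if s < T then period_space y s else return (count_space UNIV) undefined)"
    for y s
  define G where "G S = (\<integral>\<^sup>+\<theta>. \<integral>\<^sup>+x. ?f (x(t := (S, \<theta>))) \<partial>PiM ?J (L z) \<partial>customer_law M t)" for S
  \<comment> \<open>Used twice: for a policy that pins \<open>S\<close> in period \<open>t\<close>
    it identifies \<open>G S\<close>, and for \<open>z\<close> itself it gives the weighted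
    sum.\<close>
  have main: "(\<integral>\<^sup>+\<omega>. ?f \<omega> \<partial>sim_space M y) = (\<Sum>S\<in>set_pmf (y t). G S * ennreal (pmf (y t) S))"
    if y: "admissible y" "\<And>s. s \<noteq> t \<Longrightarrow> y s = z s" for y
  proof -
    have prob: "prob_space (L y s)" for s
      unfolding L_def using prob_space_period[OF y(1)] by (auto intro!: prob_space_return)
    interpret product_prob_space "L y" "{..<T}" 
      by (intro product_prob_spaceI prob)
    interpret J: prob_space "PiM ?J (L y)" using prob by (rule prob_space_PiM)
    interpret cl: prob_space "customer_law M t" using t prob_space_customer_law by blast
    have sim: "sim_space M y = PiM {..<T} (L y)"
      unfolding sim_space_def by (intro PiM_cong) (auto simp: L_def)
    have ins: "{..<T} = insert t ?J" using t by auto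
    have f[measurable]: "?f \<in> borel_measurable (PiM (insert t ?J) (L y))"
      using sim_revenue_measurable[of z y] unfolding sim ins[symmetric] by measurable
    have Lt: "L y t = period_space y t" using t by (simp add: L_def)
    have J: "PiM ?J (L y) = PiM ?J (L z)"
      by (intro PiM_cong) (auto simp: L_def y(2))
    have "(\<lambda>w. (snd w)(t := fst w))
        \<in> measurable (L y t \<Otimes>\<^sub>M PiM ?J (L y)) (PiM (insert t ?J) (L y))"
      by measurable
    then have 1: "(\<lambda>w. ?f ((snd w)(t := fst w))) \<in> borel_measurable (L y t \<Otimes>\<^sub>M PiM ?J (L y))"
      by (rule measurable_compose) (rule f)
    have 2: "(\<lambda>w. \<integral>\<^sup>+x. ?f (x(t := w)) \<partial>PiM ?J (L y)) \<in> borel_measurable (L y t)"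
      using J.borel_measurable_nn_integral_fst[OF 1] by simp
    have "(\<integral>\<^sup>+\<omega>. ?f \<omega> \<partial>sim_space M y) = (\<integral>\<^sup>+w. \<integral>\<^sup>+x. ?f (x(t := w)) \<partial>PiM ?J (L y) \<partial>L y t)"
      unfolding sim by (subst ins) (rule product_nn_integral_insert_rev, use f in \<open>auto simp del: insert_Diff_single\<close>)
    also have "\<dots> = (\<integral>\<^sup>+S. \<integral>\<^sup>+\<theta>. \<integral>\<^sup>+x. ?f (x(t := (S, \<theta>))) \<partial>PiM ?J (L y) \<partial>customer_law M t
        \<partial>restrict_space (measure_pmf (y t)) (assortments M))"
      using 2 unfolding Lt by (rule cl.nn_integral_fst[symmetric])
    also have "\<dots> = (\<integral>\<^sup>+S. G S \<partial>restrict_space (measure_pmf (y t)) (assortments M))"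
      by (simp add: G_def J)
    also have "\<dots> = (\<integral>\<^sup>+S. G S * indicator (assortments M) S \<partial>measure_pmf (y t))"
      by (subst nn_integral_restrict_space) auto
    also have "\<dots> = (\<integral>\<^sup>+S. G S \<partial>measure_pmf (y t))"
      using y(1) t by (intro nn_integral_cong_AE) (force simp: AE_measure_pmf_iff admissible_def)
    also have "\<dots> = (\<Sum>S\<in>set_pmf (y t). G S * ennreal (pmf (y t) S))"
      using y(1) t finite_subset[OF _ finite_assortments]
      by (intro nn_integral_measure_pmf_finite) (auto simp: admissible_def)
    finally show ?thesis .
  qed
  have S: "set_pmf (z t) \<subseteq> assortments M" using z t by (auto simp: admissible_def)
  have "G S = ennreal (expected_revenue M (z(t := return_pmf S)))" if "S \<in> set_pmf (z t)" for S
  proof -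
    have adm: "admissible (z(t := return_pmf S))" using z that S by (intro admissible_update) auto
    show ?thesis
      unfolding ennreal_expected_revenue[OF adm, of z] by (subst main[OF adm]) auto
  qed
  then have "ennreal (expected_revenue M z)
      = (\<Sum>S\<in>set_pmf (z t). ennreal (expected_revenue M (z(t := return_pmf S))) * ennreal (pmf (z t) S))"
    unfolding ennreal_expected_revenue[OF z, of z] by (subst main[OF z]) auto
  also have "\<dots> = (\<Sum>S\<in>set_pmf (z t). ennreal (pmf (z t) S * expected_revenue M (z(t := return_pmf S))))"
    using expected_revenue_nonneg by (intro sum.cong) (auto simp: ennreal_mult mult.commute)
  also have "\<dots> = ennreal (\<Sum>S\<in>set_pmf (z t). pmf (z t) S * expected_revenue M (z(t := return_pmf S)))"
    using expected_revenue_nonneg by (intro sum_ennreal) auto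
  finally show ?thesis
    using expected_revenue_nonneg by (subst (asm) ennreal_inj) (auto intro!: sum_nonneg)
qed

end

section \<open>Random variables with finitely many values\<close>

text \<open>\<open>embed_pmf\<close> yields the intended law only if the point masses sum to 1. The
  finite set \<open>F\<close> of possible values ensures this and turns both integrals into the same
  finite sum over level sets.\<close>

lemma discrete_law_finite:
  assumes P: "prob_space P" and f: "f \<in> measurable P (count_space UNIV)"
    and F: "finite F" "\<And>\<omega>. \<omega> \<in> space P \<Longrightarrow> f \<omega> \<in> F"
  shows set_discrete_law: "set_pmf (discrete_law P f) \<subseteq> f ` space P"
    and integral_discrete_law:
      "(\<integral>y. g y \<partial>measure_pmf (discrete_law P f)) = (\<integral>\<omega>. (g (f \<omega>) :: real) \<partial>P)"
proof -
  interpret prob_space P by (rule P)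
  define p where "p y = measure P {\<omega> \<in> space P. f \<omega> = y}" for y
  have sets: "{\<omega> \<in> space P. f \<omega> = y} \<in> sets P" for y
    using measurable_sets[OF f, of "{y}"] by (simp add: vimage_def Int_def conj_commute)
  have zero: "p y = 0" if "y \<notin> f ` space P" for y
  proof -
    have "{\<omega> \<in> space P. f \<omega> = y} = {}" using that by auto
    then show ?thesis unfolding p_def by (simp only: measure_empty)
  qed
  have "(\<Sum>y\<in>F. p y) = measure P (\<Union>y\<in>F. {\<omega> \<in> space P. f \<omega> = y})"
    unfolding p_def using F sets by (intro finite_measure_finite_Union[symmetric]) (auto simp: disjoint_family_on_def)
  also have "(\<Union>y\<in>F. {\<omega> \<in> space P. f \<omega> = y}) = space P" using F by auto
  finally have "(\<Sum>y\<in>F. p y) = 1" by (simp add: prob_space)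
  moreover have "(\<integral>\<^sup>+y. ennreal (p y) \<partial>count_space UNIV) = (\<Sum>y\<in>F. ennreal (p y))"
  proof (rule nn_integral_count_space')
    fix y assume "y \<notin> F"
    then show "ennreal (p y) = 0" using F(2) by (subst zero) auto
  qed (use F in auto)
  ultimately have "(\<integral>\<^sup>+y. ennreal (p y) \<partial>count_space UNIV) = 1"
    by (simp add: sum_ennreal p_def)
  then have pmf: "pmf (discrete_law P f) y = p y" for y
    unfolding discrete_law_def p_def by (subst pmf_embed_pmf) auto
  show set: "set_pmf (discrete_law P f) \<subseteq> f ` space P"
    using zero by (auto simp: set_pmf_eq pmf)
  have "(\<integral>\<omega>. g (f \<omega>) \<partial>P) = (\<integral>\<omega>. (\<Sum>y\<in>F. g y * indicator {\<omega> \<in> space P. f \<omega> = y} \<omega>) \<partial>P)"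
  proof (intro Bochner_Integration.integral_cong refl)
    fix \<omega> assume \<omega>: "\<omega> \<in> space P"
    have "(\<Sum>y\<in>F. g y * indicator {\<omega> \<in> space P. f \<omega> = y} \<omega>)
        = (\<Sum>y\<in>F. if y = f \<omega> then g y else 0)"
      using \<omega> by (intro sum.cong) (auto simp: indicator_def)
    then show "g (f \<omega>) = (\<Sum>y\<in>F. g y * indicator {\<omega> \<in> space P. f \<omega> = y} \<omega>)"
      using F \<omega> by simp
  qed
  also have "\<dots> = (\<Sum>y\<in>F. g y * p y)"
  proof -
    have "{\<omega> \<in> space P. f \<omega> = y} \<inter> space P = {\<omega> \<in> space P. f \<omega> = y}" for y by auto
    then show ?thesis
      using sets by (subst Bochner_Integration.integral_sum) (auto simp: p_def emeasure_eq_measure)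
  qed
  also have "\<dots> = (\<integral>y. g y \<partial>measure_pmf (discrete_law P f))"
    using set F by (subst integral_measure_pmf_real[OF F(1)]) (auto simp: pmf)
  finally show "(\<integral>y. g y \<partial>measure_pmf (discrete_law P f)) = (\<integral>\<omega>. g (f \<omega>) \<partial>P)" by simp
qed

section \<open>One iteration of Algorithm 4\<close>

locale iteration = valid +
  fixes z :: policy and h :: "assortment list" and K :: nat
  assumes z: "admissible z"
    and length_h: "length h < T"
    and h: "\<And>s. s < length h \<Longrightarrow> h ! s \<in> assortments M"
begin

definition candidates :: "assortment set" where
  "candidates = set_pmf (z (length h))"

definition runs :: "(assortment \<times> nat \<Rightarrow> nat \<Rightarrow> assortment \<times> customer) measure" where
  "runs = PiM (candidates \<times> {..<K}) (\<lambda>(S, k). sim_space M (pin z (h @ [S])))"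

definition val :: "assortment \<Rightarrow> real" where
  "val S = expected_revenue M (pin z (h @ [S]))"

abbreviation est where "est \<equiv> estimate M z K h"

abbreviation best :: "(assortment \<times> nat \<Rightarrow> nat \<Rightarrow> assortment \<times> customer) \<Rightarrow> assortment set" where
  "best \<omega> \<equiv> {S \<in> candidates. \<forall>S'\<in>candidates. est \<omega> S' \<le> est \<omega> S}"

text \<open>Closed form of the cost of \<open>alg4_step\<close>. Being independent of the outcome,
  it leaves only the chosen assortment random, so the step has finitely many results.\<close>

definition iteration_ops :: nat where
  "iteration_ops = (\<Sum>S\<in>candidates.
     3 + K * (n + (\<Sum>t<T. 2 + 2 * card (set_pmf (pin z (h @ [S]) t)) + 8 * n) + 1)) + 1"

lemma candidates: "candidates \<subseteq> assortments M" "finite candidates" "candidates \<noteq> {}"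
proof -
  show "candidates \<subseteq> assortments M"
    using z length_h by (auto simp: candidates_def admissible_def)
  then show "finite candidates" by (rule finite_subset[OF _ finite_assortments])
  show "candidates \<noteq> {}" by (simp add: candidates_def set_pmf_not_empty)
qed

lemma pin_snoc: "pin z (h @ [S]) = (pin z h)(length h := return_pmf S)"
  by (auto simp: pin_def nth_append fun_eq_iff)

lemma admissible_pin: "admissible (pin z h)"
  using z h by (auto simp: admissible_def pin_def)

lemma admissible_pin_snoc: "S \<in> candidates \<Longrightarrow> admissible (pin z (h @ [S]))"
  unfolding pin_snoc using candidates admissible_pin by (intro admissible_update) auto

text \<open>The current value is a weighted mean of the values of the candidates, so an exact
  maximizer would lose nothing.\<close>

lemma expected_revenue_pin:
  "expected_revenue M (pin z h) = (\<Sum>S\<in>candidates. pmf (z (length h)) S * val S)"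
  using expected_revenue_condition_period[OF admissible_pin length_h]
  by (simp add: candidates_def val_def pin_snoc) (simp add: pin_def)

section \<open>Independent runs: unbiasedness and exponential moments\<close>

lemma prob_space_run: "S \<in> candidates \<Longrightarrow> prob_space (sim_space M (pin z (h @ [S])))"
  by (intro prob_space_sim_space admissible_pin_snoc)

lemma prob_space_runs: "prob_space runs"
  unfolding runs_def using prob_space_run by (intro prob_space_PiM) auto

lemma run_measurable:
  assumes "S \<in> candidates" "k < K"
  shows "(\<lambda>\<omega>. \<omega> (S, k)) \<in> measurable runs (sim_space M (pin z (h @ [S])))"
proof -
  have "(\<lambda>\<omega>. \<omega> (S, k)) \<in> measurable runs ((\<lambda>(S, k). sim_space M (pin z (h @ [S]))) (S, k))"
    unfolding runs_def using assms by (intro measurable_component_singleton) auto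
  then show ?thesis by simp
qed

lemma run_revenue_measurable:
  "S \<in> candidates \<Longrightarrow> k < K \<Longrightarrow> (\<lambda>\<omega>. sim_revenue M z' (\<omega> (S, k))) \<in> borel_measurable runs"
  by (rule measurable_compose[OF run_measurable sim_revenue_measurable])

lemma estimate_measurable: "S \<in> candidates \<Longrightarrow> (\<lambda>\<omega>. est \<omega> S) \<in> borel_measurable runs"
  unfolding estimate_def using run_revenue_measurable
  by (intro borel_measurable_divide borel_measurable_sum) auto

lemma run_revenue_integral:
  assumes "S \<in> candidates" "k < K"
  shows "integrable runs (\<lambda>\<omega>. sim_revenue M (pin z (h @ [S])) (\<omega> (S, k)))"
    and "(\<integral>\<omega>. sim_revenue M (pin z (h @ [S])) (\<omega> (S, k)) \<partial>runs) = val S"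
proof -
  let ?N = "\<lambda>(S, k). sim_space M (pin z (h @ [S]))"
  have distr: "distr runs (sim_space M (pin z (h @ [S]))) (\<lambda>\<omega>. \<omega> (S, k)) = sim_space M (pin z (h @ [S]))"
    using distr_PiM_component[of "candidates \<times> {..<K}" ?N "(S, k)"] assms prob_space_run
    by (auto simp: runs_def)
  have int: "integrable (sim_space M (pin z (h @ [S]))) (sim_revenue M (pin z (h @ [S])))"
    using assms admissible_pin_snoc by (intro sim_revenue_integrable)
  show "integrable runs (\<lambda>\<omega>. sim_revenue M (pin z (h @ [S])) (\<omega> (S, k)))"
    by (rule integrable_distr[OF run_measurable[OF assms]]) (use int in \<open>simp add: distr\<close>)
  have "(\<integral>\<omega>. sim_revenue M (pin z (h @ [S])) (\<omega> (S, k)) \<partial>runs)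
      = (\<integral>\<omega>. sim_revenue M (pin z (h @ [S])) \<omega> \<partial>distr runs (sim_space M (pin z (h @ [S]))) (\<lambda>\<omega>. \<omega> (S, k)))"
    using run_measurable[OF assms] sim_revenue_measurable by (intro integral_distr[symmetric])
  then show "(\<integral>\<omega>. sim_revenue M (pin z (h @ [S])) (\<omega> (S, k)) \<partial>runs) = val S"
    by (simp add: distr val_def expected_revenue_def)
qed

text \<open>The estimate is unbiased. With \<open>K = 0\<close> it would be the constant
  \<open>0 / 0 = 0\<close>, hence the positivity of \<open>K\<close>.\<close>

lemma estimate_integral:
  assumes "S \<in> candidates" "0 < K"
  shows "integrable runs (\<lambda>\<omega>. est \<omega> S)" "(\<integral>\<omega>. est \<omega> S \<partial>runs) = val S"
proof -
  show "integrable runs (\<lambda>\<omega>. est \<omega> S)"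
    unfolding estimate_def using run_revenue_integral(1)[OF assms(1)]
    by (intro integrable_divide Bochner_Integration.integrable_sum) auto
  show "(\<integral>\<omega>. est \<omega> S \<partial>runs) = val S"
    unfolding estimate_def using run_revenue_integral[OF assms(1)] assms(2)
    by (simp add: Bochner_Integration.integral_sum)
qed

text \<open>Hoeffding's lemma with parameter \<open>l / K\<close> for a single run, multiplied over
  \<open>K\<close> independent runs: the exponents add up to
  \<open>K * ((l / K)\<^sup>2 * R\<^sup>2 / 8)\<close>.\<close>

lemma estimate_exp_moment:
  assumes S: "S \<in> candidates" and K: "0 < K" and l: "0 < l"
  shows "integrable runs (\<lambda>\<omega>. exp (l * (est \<omega> S - val S)))"
    and "(\<integral>\<omega>. exp (l * (est \<omega> S - val S)) \<partial>runs) \<le> exp (l\<^sup>2 * R\<^sup>2 / (8 * K))"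
proof -
  \<comment> \<open>The default is again a point mass, since all factors must be probability
    spaces.\<close>
  define N where "N i = (if fst i \<in> candidates then sim_space M (pin z (h @ [fst i]))
    else return (count_space UNIV) undefined)" for i :: "assortment \<times> nat"
  define X where "X \<omega> = exp (l / K * (sim_revenue M (pin z (h @ [S])) \<omega> - val S))" for \<omega>
  interpret product_prob_space N "candidates \<times> {..<K}"
    by (intro product_prob_spaceI) (auto simp: N_def prob_space_run intro!: prob_space_return)
  have runs: "runs = PiM (candidates \<times> {..<K}) N"
    unfolding runs_def by (intro PiM_cong) (auto simp: N_def)
  interpret S: interval_bounded_random_variable "sim_space M (pin z (h @ [S]))"
      "sim_revenue M (pin z (h @ [S]))" 0 R
  proof -
    interpret prob_space "sim_space M (pin z (h @ [S]))" by (rule prob_space_run[OF S])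
    show "interval_bounded_random_variable (sim_space M (pin z (h @ [S])))
        (sim_revenue M (pin z (h @ [S]))) 0 R"
      using sim_revenue_measurable sim_revenue_bounds by unfold_locales (auto intro!: AE_I2)
  qed
  have "(\<integral>\<^sup>+\<omega>. ennreal (X \<omega>) \<partial>sim_space M (pin z (h @ [S]))) \<le> ennreal (exp ((l / K)\<^sup>2 * R\<^sup>2 / 8))"
    using S.Hoeffdings_lemma_nn_integral[of "l / K"] l K
    by (simp add: X_def val_def expected_revenue_def)
  note hoeffding = this
  have X[measurable]: "X \<in> borel_measurable (sim_space M y)" for y
    using sim_revenue_measurable[of "pin z (h @ [S])" y] unfolding X_def by measurable
  \<comment> \<open>Runs of the other candidates contribute the factor 1, so that the product
    extends over the full index set of \<open>runs\<close>.\<close>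
  have est: "exp (l * (est \<omega> S - val S))
      = (\<Prod>i\<in>candidates \<times> {..<K}. if fst i = S then X (\<omega> i) else 1)" for \<omega>
  proof -
    have "(\<Prod>i\<in>candidates \<times> {..<K}. if fst i = S then X (\<omega> i) else 1)
        = (\<Prod>i\<in>{S} \<times> {..<K}. X (\<omega> i))"
      using S candidates by (intro prod.mono_neutral_cong_right) auto
    also have "\<dots> = exp (\<Sum>k<K. l / K * (sim_revenue M (pin z (h @ [S])) (\<omega> (S, k)) - val S))"
      by (subst prod.cartesian_product') (simp add: X_def exp_sum)
    also have "(\<Sum>k<K. l / K * (sim_revenue M (pin z (h @ [S])) (\<omega> (S, k)) - val S))
        = l * (est \<omega> S - val S)"
      unfolding sum_distrib_left[symmetric] sum_subtractf
      using K by (simp add: estimate_def field_simps)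
    finally show ?thesis by simp
  qed
  have "(\<integral>\<^sup>+\<omega>. ennreal (exp (l * (est \<omega> S - val S))) \<partial>runs)
      = (\<integral>\<^sup>+\<omega>. (\<Prod>i\<in>candidates \<times> {..<K}. if fst i = S then ennreal (X (\<omega> i)) else 1) \<partial>runs)"
    unfolding est by (intro nn_integral_cong) (auto simp: X_def prod_ennreal[symmetric] intro!: prod.cong)
  also have "\<dots> = (\<Prod>i\<in>candidates \<times> {..<K}. \<integral>\<^sup>+\<omega>. (if fst i = S then ennreal (X \<omega>) else 1) \<partial>N i)"
    unfolding runs using candidates by (intro product_nn_integral_prod) (auto simp: N_def)
  also have "\<dots> \<le> (\<Prod>i\<in>candidates \<times> {..<K}. if fst i = S then ennreal (exp ((l / K)\<^sup>2 * R\<^sup>2 / 8)) else 1)"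
  proof (intro prod_mono_ennreal)
    fix i :: "assortment \<times> nat"
    show "(\<integral>\<^sup>+\<omega>. (if fst i = S then ennreal (X \<omega>) else 1) \<partial>N i)
        \<le> (if fst i = S then ennreal (exp ((l / K)\<^sup>2 * R\<^sup>2 / 8)) else 1)"
      using hoeffding S M.emeasure_space_1[of i] by (auto simp: N_def)
  qed
  also have "\<dots> = (\<Prod>i\<in>{S} \<times> {..<K}. ennreal (exp ((l / K)\<^sup>2 * R\<^sup>2 / 8)))"
    using S candidates by (intro prod.mono_neutral_cong_right) auto
  also have "\<dots> = ennreal (exp (l\<^sup>2 * R\<^sup>2 / (8 * K)))"
    using K by (simp add: ennreal_power exp_of_nat_mult[symmetric] power_divide power2_eq_square)
  finally have le: "(\<integral>\<^sup>+\<omega>. ennreal (exp (l * (est \<omega> S - val S))) \<partial>runs)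
      \<le> ennreal (exp (l\<^sup>2 * R\<^sup>2 / (8 * K)))" .
  have meas: "(\<lambda>\<omega>. exp (l * (est \<omega> S - val S))) \<in> borel_measurable runs"
    using estimate_measurable[OF S] by measurable
  show "integrable runs (\<lambda>\<omega>. exp (l * (est \<omega> S - val S)))"
    using meas le by (intro integrableI_nonneg) (auto simp: less_top intro: le_less_trans)
  show "(\<integral>\<omega>. exp (l * (est \<omega> S - val S)) \<partial>runs) \<le> exp (l\<^sup>2 * R\<^sup>2 / (8 * K))"
    using le meas by (intro integral_real_bounded) auto
qed

section \<open>Choosing a maximizer and the resulting loss\<close>

context
  fixes sel :: tie_break
  assumes sel: "valid_tie_break sel"
begin

text \<open>The set of maximizers has finitely many values, each described by finitely many
  comparisons of estimates. Measurability is shown for the whole set, so that any tie-breaking rule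
  may follow.\<close>

lemma best_measurable: "best \<in> measurable runs (count_space UNIV)"
proof -
  have "best -` {B} \<inter> space runs \<in> sets runs" if "B \<subseteq> candidates" for B
  proof -
    have "best -` {B} \<inter> space runs
        = {\<omega> \<in> space runs. \<forall>S\<in>candidates. (\<forall>S'\<in>candidates. est \<omega> S' \<le> est \<omega> S) = (S \<in> B)}"
      using that by auto
    also have "\<dots> \<in> sets runs"
    proof (rule sets.sets_Collect_finite_All[OF _ candidates(2)])
      fix S assume S: "S \<in> candidates"
      have "{\<omega> \<in> space runs. \<forall>S'\<in>candidates. est \<omega> S' \<le> est \<omega> S} \<in> sets runs"
        using estimate_measurable S
        by (intro sets.sets_Collect_finite_All[OF _ candidates(2)] borel_measurable_le) auto
      then show "{\<omega> \<in> space runs. (\<forall>S'\<in>candidates. est \<omega> S' \<le> est \<omega> S) = (S \<in> B)} \<in> sets runs"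
        using sets.sets_Collect_neg[of runs "\<lambda>\<omega>. \<forall>S'\<in>candidates. est \<omega> S' \<le> est \<omega> S"]
        by (cases "S \<in> B") simp_all
    qed
    finally show ?thesis .
  qed
  then have "best \<in> measurable runs (count_space (Pow candidates))"
    using candidates by (subst measurable_count_space_eq2) auto
  moreover have "(\<lambda>B. B) \<in> measurable (count_space (Pow candidates)) (count_space UNIV)" by simp
  ultimately show ?thesis by (rule measurable_compose)
qed

lemma chosen: 
  shows "sel h (best \<omega>) \<in> candidates"
    and "S \<in> candidates \<Longrightarrow> est \<omega> S \<le> est \<omega> (sel h (best \<omega>))"
proof -
  have "Max (est \<omega> ` candidates) \<in> est \<omega> ` candidates" using candidates by (intro Max_in) auto
  then obtain S where "S \<in> candidates" "est \<omega> S = Max (est \<omega> ` candidates)" by auto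
  then have "S \<in> best \<omega>" using candidates by auto
  then have "best \<omega> \<noteq> {}" by blast
  moreover have "finite (best \<omega>)" using candidates(2) by simp
  ultimately have "sel h (best \<omega>) \<in> best \<omega>" using sel unfolding valid_tie_break_def by blast
  then show "sel h (best \<omega>) \<in> candidates" "S \<in> candidates \<Longrightarrow> est \<omega> S \<le> est \<omega> (sel h (best \<omega>))" for S
    by auto
qed

lemma alg4_step_eq:
  "alg4_step M z sel K (h, c)
    = discrete_law runs (\<lambda>\<omega>. (h @ [sel h (best \<omega>)], c + iteration_ops))"
  by (simp add: alg4_step_def Let_def runs_def candidates_def iteration_ops_def sim_ops_eq
      sum.distrib add.assoc)

lemma outcome:
  shows outcome_measurable:
      "(\<lambda>\<omega>. (h @ [sel h (best \<omega>)], c + iteration_ops)) \<in> measurable runs (count_space UNIV)"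
    and outcome_finite: "finite ((\<lambda>S. (h @ [S], c + iteration_ops)) ` candidates)"
    and outcome_in: "(h @ [sel h (best \<omega>)], c + iteration_ops)
      \<in> (\<lambda>S. (h @ [S], c + iteration_ops)) ` candidates"
  using measurable_compose[OF best_measurable, of "\<lambda>B. (h @ [sel h B], c + iteration_ops)"]
    candidates chosen(1) by auto

lemma alg4_step_support:
  "set_pmf (alg4_step M z sel K (h, c)) \<subseteq> (\<lambda>S. (h @ [S], c + iteration_ops)) ` candidates"
  unfolding alg4_step_eq
  using set_discrete_law[OF prob_space_runs outcome_measurable outcome_finite outcome_in, of c]
    outcome_in by blast

lemma alg4_step_expectation:
  "(\<integral>(h', c'). expected_revenue M (pin z h') \<partial>measure_pmf (alg4_step M z sel K (h, c)))
    = (\<integral>\<omega>. val (sel h (best \<omega>)) \<partial>runs)"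
  unfolding alg4_step_eq
  by (subst integral_discrete_law[OF prob_space_runs outcome_measurable outcome_finite outcome_in])
    (simp add: val_def)

lemma val_chosen_integrable: "integrable runs (\<lambda>\<omega>. val (sel h (best \<omega>)))"
proof -
  interpret prob_space runs by (rule prob_space_runs)
  have "(\<lambda>\<omega>. val (sel h (best \<omega>))) \<in> borel_measurable runs"
    by (rule measurable_compose[OF best_measurable]) simp
  moreover have "\<bar>val (sel h (best \<omega>))\<bar> \<le> Max ((\<lambda>S. \<bar>val S\<bar>) ` candidates)" for \<omega>
    using chosen(1) candidates by (intro Max_ge) auto
  ultimately show ?thesis by (intro integrable_const_bound) auto
qed

lemma single_candidate_expectation:
  assumes "card candidates = 1"
  shows "expected_revenue M (pin z h)
    = (\<integral>(h', c'). expected_revenue M (pin z h') \<partial>measure_pmf (alg4_step M z sel K (h, c)))"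
proof -
  interpret prob_space runs by (rule prob_space_runs)
  obtain S where S: "candidates = {S}" using assms card_1_singletonE by blast
  then have "sel h (best \<omega>) = S" for \<omega> using chosen(1) by blast
  moreover have "pmf (z (length h)) S = 1"
    using S set_pmf_subset_singleton[of "z (length h)" S] by (simp add: candidates_def)
  ultimately show ?thesis
    unfolding alg4_step_expectation expected_revenue_pin S by (simp add: prob_space)
qed

text \<open>
  The largest of the deviations \<open>est - val\<close> is bounded through its exponential moments. The
  tangent \<open>u \<le> a - 1 + exp (u - a)\<close> of the exponential replaces Jensen's inequality, and the choice
  of \<open>a\<close> makes the expectation of the right-hand side at most \<open>a\<close>.
\<close>

lemma alg4_step_loss:
  assumes K: "0 < K" and l: "0 < l"
  shows "expected_revenue M (pin z h) - (ln (card candidates) / l + l * R\<^sup>2 / (8 * K))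
    \<le> (\<integral>(h', c'). expected_revenue M (pin z h') \<partial>measure_pmf (alg4_step M z sel K (h, c)))"
proof -
  interpret prob_space runs by (rule prob_space_runs)
  define D where "D S \<omega> = est \<omega> S - val S" for S \<omega>
  define w where "w S = pmf (z (length h)) S" for S
  define a where "a = ln (card candidates) + l\<^sup>2 * R\<^sup>2 / (8 * K)"
  have card: "0 < card candidates" using candidates by (simp add: card_gt_0_iff)
  have w: "(\<Sum>S\<in>candidates. w S) = 1" "\<And>S. 0 \<le> w S"
    unfolding w_def candidates_def using candidates(2)
    by (auto simp: candidates_def intro: sum_pmf_eq_1)
  let ?rhs = "\<lambda>\<omega>. l * expected_revenue M (pin z h) + l * (\<Sum>S\<in>candidates. w S * D S \<omega>)
      - (a - 1 + exp (- a) * (\<Sum>S\<in>candidates. exp (l * D S \<omega>)))"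
  have D: "integrable runs (D S)" "(\<integral>\<omega>. D S \<omega> \<partial>runs) = 0" if "S \<in> candidates" for S
    unfolding D_def using estimate_integral[OF that K] by (auto simp: prob_space)
  have eD: "integrable runs (\<lambda>\<omega>. exp (l * D S \<omega>))"
      "(\<integral>\<omega>. exp (l * D S \<omega>) \<partial>runs) \<le> exp (l\<^sup>2 * R\<^sup>2 / (8 * K))" if "S \<in> candidates" for S
    unfolding D_def using estimate_exp_moment[OF that K l] by auto
  have pointwise: "?rhs \<omega> \<le> l * val (sel h (best \<omega>))" for \<omega>
  proof -
    let ?S = "sel h (best \<omega>)"
    have "1 + (l * D ?S \<omega> - a) \<le> exp (l * D ?S \<omega> - a)" by (rule exp_ge_add_one_self)
    also have "\<dots> = exp (- a) * exp (l * D ?S \<omega>)" by (simp add: exp_diff exp_minus field_simps)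
    also have "\<dots> \<le> exp (- a) * (\<Sum>S\<in>candidates. exp (l * D S \<omega>))"
      using chosen(1) candidates by (intro mult_left_mono member_le_sum) auto
    finally have 1: "l * D ?S \<omega> \<le> a - 1 + exp (- a) * (\<Sum>S\<in>candidates. exp (l * D S \<omega>))" by simp
    \<comment> \<open>The chosen estimate is at least the weighted mean of all estimates. The mean
      deviation appearing here has expectation zero, so only the deviation of the chosen candidate
      costs anything.\<close>
    have "expected_revenue M (pin z h) + (\<Sum>S\<in>candidates. w S * D S \<omega>) = (\<Sum>S\<in>candidates. w S * est \<omega> S)"
      by (simp add: expected_revenue_pin w_def D_def algebra_simps sum.distrib sum_subtractf)
    also have "\<dots> \<le> (\<Sum>S\<in>candidates. w S * est \<omega> ?S)"
      using w chosen(2) by (intro sum_mono mult_left_mono) auto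
    also have "\<dots> = val ?S + D ?S \<omega>" by (simp add: D_def sum_distrib_right[symmetric] w)
    finally have "l * (expected_revenue M (pin z h) + (\<Sum>S\<in>candidates. w S * D S \<omega>)) \<le> l * (val ?S + D ?S \<omega>)"
      using l by (intro mult_left_mono) auto
    with 1 show ?thesis by (simp add: distrib_left)
  qed
  have "(\<Sum>S\<in>candidates. \<integral>\<omega>. exp (l * D S \<omega>) \<partial>runs) \<le> card candidates * exp (l\<^sup>2 * R\<^sup>2 / (8 * K))"
    using eD(2) by (intro sum_bounded_above) auto
  also have "\<dots> = exp a" using card by (simp add: a_def exp_add)
  finally have moments: "exp (- a) * (\<Sum>S\<in>candidates. \<integral>\<omega>. exp (l * D S \<omega>) \<partial>runs) \<le> 1"
    by (simp add: exp_minus field_simps)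
  have "l * expected_revenue M (pin z h) - a \<le> (\<integral>\<omega>. ?rhs \<omega> \<partial>runs)"
    using moments D eD by (simp add: prob_space)
  also have "\<dots> \<le> (\<integral>\<omega>. l * val (sel h (best \<omega>)) \<partial>runs)"
    using D eD val_chosen_integrable pointwise by (intro integral_mono) auto
  also have "\<dots> = l * (\<integral>\<omega>. val (sel h (best \<omega>)) \<partial>runs)" by simp
  finally have "expected_revenue M (pin z h) - a / l \<le> (\<integral>\<omega>. val (sel h (best \<omega>)) \<partial>runs)"
    using l by (simp add: field_simps)
  moreover have "a / l = ln (card candidates) / l + l * R\<^sup>2 / (8 * K)"
    using l by (simp add: a_def add_divide_distrib power2_eq_square)
  ultimately show ?thesis unfolding alg4_step_expectation by simp
qed

end

end

section \<open>The full run\<close>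

context valid
begin

text \<open>Invariant of the reachable states: the conditions on \<open>h\<close> make the locale
  \<open>iteration\<close> available in the next period, and finite support allows expectations to
  be written as finite sums.\<close>

lemma alg4_run_support:
  assumes z: "admissible z" and sel: "valid_tie_break sel"
    and cost: "\<And>h. iteration M z h \<Longrightarrow> iteration.iteration_ops M z h K \<le> b"
  shows "t \<le> T \<Longrightarrow> (h, c) \<in> set_pmf (alg4_run M z sel K c0 t) \<Longrightarrow>
    length h = t \<and> (\<forall>s<t. h ! s \<in> assortments M) \<and> c \<le> c0 + t * b"
    and "t \<le> T \<Longrightarrow> finite (set_pmf (alg4_run M z sel K c0 t))"
proof -
  have "finite (set_pmf (alg4_run M z sel K c0 t)) \<and> (\<forall>(h, c)\<in>set_pmf (alg4_run M z sel K c0 t).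
    length h = t \<and> (\<forall>s<t. h ! s \<in> assortments M) \<and> c \<le> c0 + t * b)" if "t \<le> T" for t
    using that
  proof (induction t)
    case (Suc t)
    let ?p = "alg4_run M z sel K c0 t"
    have IH: "finite (set_pmf ?p)" "\<And>h c. (h, c) \<in> set_pmf ?p \<Longrightarrow>
        length h = t \<and> (\<forall>s<t. h ! s \<in> assortments M) \<and> c \<le> c0 + t * b"
      using Suc by auto
    have step: "finite (set_pmf (alg4_step M z sel K x)) \<and> (\<forall>(h, c)\<in>set_pmf (alg4_step M z sel K x).
      length h = Suc t \<and> (\<forall>s<Suc t. h ! s \<in> assortments M) \<and> c \<le> c0 + Suc t * b)"
      if "x \<in> set_pmf ?p" for x
    proof -
      obtain h c where x: "x = (h, c)" by force
      have hs: "length h = t" "\<And>s. s < t \<Longrightarrow> h ! s \<in> assortments M" "c \<le> c0 + t * b"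
        using IH(2) that x by auto
      interpret iteration M z h K
        by unfold_locales (use z hs Suc.prems in auto)
      have b: "iteration_ops \<le> b" by (rule cost) unfold_locales
      show ?thesis
      proof (intro conjI ballI)
        show "finite (set_pmf (alg4_step M z sel K x))"
          unfolding x by (rule finite_surj[OF candidates(2) alg4_step_support[OF sel]])
        fix y assume "y \<in> set_pmf (alg4_step M z sel K x)"
        then obtain S where S: "S \<in> candidates" and y: "y = (h @ [S], c + iteration_ops)"
          using alg4_step_support[OF sel, of c] unfolding x by blast
        have "S \<in> assortments M" using S candidates by blast
        then have "(h @ [S]) ! s \<in> assortments M" if "s < Suc t" for s
          using hs(2) that unfolding nth_append hs(1) by (cases "s = t") auto
        then show "case y of (h, c) \<Rightarrow>
            length h = Suc t \<and> (\<forall>s<Suc t. h ! s \<in> assortments M) \<and> c \<le> c0 + Suc t * b"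
          using hs b by (simp add: y)
      qed
    qed
    then show ?case using IH(1) by (fastforce simp: set_bind_pmf)
  qed simp
  then show "t \<le> T \<Longrightarrow> (h, c) \<in> set_pmf (alg4_run M z sel K c0 t) \<Longrightarrow>
    length h = t \<and> (\<forall>s<t. h ! s \<in> assortments M) \<and> c \<le> c0 + t * b"
    and "t \<le> T \<Longrightarrow> finite (set_pmf (alg4_run M z sel K c0 t))"
    by blast+
qed

text \<open>Tower property: each step loses at most \<open>g\<close> in expectation from every
  reachable state, and the losses add up over the periods.\<close>

lemma alg4_run_expectation:
  assumes z: "admissible z" and sel: "valid_tie_break sel"
    and cost: "\<And>h. iteration M z h \<Longrightarrow> iteration.iteration_ops M z h K \<le> b"
    and loss: "\<And>h c. iteration M z h \<Longrightarrow> expected_revenue M (pin z h) - g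
      \<le> (\<integral>(h', c'). expected_revenue M (pin z h') \<partial>measure_pmf (alg4_step M z sel K (h, c)))"
  shows "t \<le> T \<Longrightarrow> expected_revenue M z - t * g
    \<le> (\<integral>(h, c). expected_revenue M (pin z h) \<partial>measure_pmf (alg4_run M z sel K c0 t))"
proof (induction t)
  case 0
  have "pin z [] = z" by (simp add: pin_def)
  then show ?case by simp
next
  case (Suc t)
  let ?V = "\<lambda>(h, c :: nat). expected_revenue M (pin z h)"
  let ?p = "alg4_run M z sel K c0 t"
  note support = alg4_run_support[OF z sel cost]
  have fin: "finite (set_pmf ?p)" using support(2) Suc.prems by simp
  have iter: "iteration M z h" if "(h, c) \<in> set_pmf ?p" for h c
    using support(1)[OF _ _ that] Suc.prems z by unfold_locales auto
  have fin_step: "finite (set_pmf (alg4_step M z sel K x))" if "x \<in> set_pmf ?p" for x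
  proof -
    obtain h c where x: "x = (h, c)" by force
    interpret iteration M z h K using iter that unfolding x by blast
    show ?thesis unfolding x by (rule finite_surj[OF candidates(2) alg4_step_support[OF sel]])
  qed
  have "expected_revenue M z - Suc t * g \<le> (\<integral>x. ?V x \<partial>measure_pmf ?p) - g"
    using Suc by (simp add: algebra_simps)
  also have "\<dots> = (\<Sum>x\<in>set_pmf ?p. pmf ?p x * (?V x - g))"
  proof -
    have "(\<integral>x. ?V x \<partial>measure_pmf ?p) = (\<Sum>x\<in>set_pmf ?p. pmf ?p x * ?V x)"
      by (subst integral_measure_pmf_real[OF fin]) (auto simp: mult.commute)
    moreover have "(\<Sum>x\<in>set_pmf ?p. pmf ?p x * g) = g"
      using sum_pmf_eq_1[OF fin order_refl] by (simp flip: sum_distrib_right)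
    ultimately show ?thesis by (simp add: right_diff_distrib sum_subtractf)
  qed
  also have "\<dots> \<le> (\<Sum>x\<in>set_pmf ?p. pmf ?p x * (\<integral>y. ?V y \<partial>measure_pmf (alg4_step M z sel K x)))"
  proof (intro sum_mono mult_left_mono pmf_nonneg)
    fix x assume "x \<in> set_pmf ?p"
    then show "?V x - g \<le> (\<integral>y. ?V y \<partial>measure_pmf (alg4_step M z sel K x))"
      using loss iter by (cases x) auto
  qed
  also have "\<dots> = (\<integral>y. ?V y \<partial>measure_pmf (alg4_run M z sel K c0 (Suc t)))"
    using fin_step by (simp add: pmf_expectation_bind[OF fin _ order_refl])
  finally show ?case .
qed

section \<open>Operations of one iteration and number of runs\<close>

text \<open>As \<open>n \<ge> 1\<close>, a period costs at most
  \<open>2 + 2 * (n + 2) + 8 * n \<le> 16 * n\<close>, a run with its addition at most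
  \<open>18 * n * T\<close>, and there are at most \<open>n + 2 \<le> 3 * n\<close> candidates. The
  overhead is \<open>3 * (3 * n) + 1 \<le> 10 * n\<close>.\<close>

lemma iteration_ops_le:
  assumes "iteration M z h" and card: "\<And>t. t < T \<Longrightarrow> card (set_pmf (z t)) \<le> n + 2"
  shows "iteration.iteration_ops M z h K \<le> 10 * n + 54 * n * n * T * K"
proof -
  interpret iteration M z h K by (rule assms)
  have "(\<Sum>t<T. 2 + 2 * card (set_pmf (pin z (h @ [S]) t)) + 8 * n) \<le> (\<Sum>t<T. 16 * n)" for S
  proof (rule sum_mono)
    fix t assume "t \<in> {..<T}"
    then have "card (set_pmf (pin z (h @ [S]) t)) \<le> n + 2" using card by (simp add: pin_def)
    then show "2 + 2 * card (set_pmf (pin z (h @ [S]) t)) + 8 * n \<le> 16 * n" using n_pos by linarith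
  qed
  then have 1: "(\<Sum>t<T. 2 + 2 * card (set_pmf (pin z (h @ [S]) t)) + 8 * n) \<le> 16 * (n * T)" for S
    by (simp only: sum_constant card_lessThan mult_ac of_nat_id)
  have 2: "n \<le> n * T" "1 \<le> n * T" using n_pos T_pos by auto
  have ops: "n + (\<Sum>t<T. 2 + 2 * card (set_pmf (pin z (h @ [S]) t)) + 8 * n) + 1
      \<le> 18 * (n * T)" for S
  proof -
    have "a + x + 1 \<le> 18 * y" if "a \<le> y" "x \<le> 16 * y" "1 \<le> y" for a x y :: nat
      using that by linarith
    then show ?thesis using 1 2 by blast
  qed
  have "iteration_ops \<le> (\<Sum>S\<in>candidates. 3 + K * (18 * (n * T))) + 1"
    unfolding iteration_ops_def using ops by (intro add_mono sum_mono mult_left_mono) auto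
  also have "\<dots> = card candidates * (3 + K * (18 * (n * T))) + 1" by simp
  also have "\<dots> \<le> (3 * n) * (3 + K * (18 * (n * T))) + n"
  proof (intro add_mono mult_right_mono)
    have "card candidates \<le> n + 2" unfolding candidates_def using card length_h by simp
    then show "card candidates \<le> 3 * n" using n_pos by linarith
  qed (use n_pos in auto)
  also have "\<dots> = 10 * n + 54 * n * n * T * K" by (simp add: algebra_simps)
  finally show ?thesis .
qed

text \<open>Serves to bound the logarithm of the number of candidates by twice
  \<open>ln n + ln T\<close>, the factor that appears in the number of runs.\<close>

lemma candidates_le_square:
  assumes "n * T \<noteq> 1"
  shows "n + 2 \<le> (n * T)\<^sup>2"
proof (cases "n = 1")
  case True
  then have "2 \<le> T" using assms T_pos by simp
  then have "2\<^sup>2 \<le> T\<^sup>2" by (rule power_mono) simp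
  then show ?thesis using True by simp
next
  case False
  then have "2 \<le> n" using n_pos by simp
  then have "n + 2 \<le> 2 * n" by simp
  also have "2 * n \<le> n * n" using \<open>2 \<le> n\<close> by (intro mult_right_mono) auto
  also have "\<dots> \<le> (n * T) * (n * T)" using T_pos by (intro mult_mono) auto
  finally show ?thesis by (simp add: power2_eq_square)
qed

text \<open>\<open>2 / 3\<close> is a lower bound for \<open>ln 2\<close>. A constant rather than
  mere positivity allows the additive terms of the operation count to be absorbed.\<close>

lemma ln_nT_pos:
  assumes "n * T \<noteq> 1"
  shows "2 / 3 \<le> ln (real n) + ln (real T)" "ln (real n) + ln (real T) = ln (real (n * T))"
proof -
  show *: "ln (real n) + ln (real T) = ln (real (n * T))"
    using n_pos T_pos by (simp add: ln_mult)
  have "1 \<le> n * T" using n_pos T_pos by simp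
  then have "2 \<le> n * T" using assms by linarith
  then have "2 \<le> real (n * T)" by (metis of_nat_le_iff of_nat_numeral)
  then have "ln 2 \<le> ln (real (n * T))" by (subst ln_le_cancel_iff) auto
  then show "2 / 3 \<le> ln (real n) + ln (real T)" using ln2_ge_two_thirds * by simp
qed

lemma num_runs_bounds:
  fixes \<epsilon> :: real
  defines "x \<equiv> (real T)\<^sup>2 * R\<^sup>2 / (opt_lp M)\<^sup>2 * (1 / \<epsilon>\<^sup>2) * (ln (real n) + ln (real T))"
  shows "x \<le> num_runs M \<epsilon>" "real (num_runs M \<epsilon>) \<le> x + 1"
proof -
  have eq: "num_runs M \<epsilon> = nat \<lceil>x\<rceil>" by (simp add: num_runs_def x_def power_mult_distrib mult.assoc)
  have "0 \<le> ln (real n) + ln (real T)" using n_pos T_pos by (intro add_nonneg_nonneg ln_ge_zero) auto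
  then have "0 \<le> x" unfolding x_def by (intro mult_nonneg_nonneg) auto
  then show "x \<le> num_runs M \<epsilon>" "real (num_runs M \<epsilon>) \<le> x + 1" unfolding eq by linarith+
qed

text \<open>With \<open>g\<close> the loss allowed per period, the number of runs is at least
  \<open>R\<^sup>2 * L / g\<^sup>2\<close>, where \<open>L = ln n + ln T\<close>; this is what the
  general loss bound needs.\<close>

lemma alg4_step_loss_eps:
  assumes alg: "algorithm1 M z \<or> algorithm2 M z \<or> algorithm3 M z" and sel: "valid_tie_break sel"
    and \<epsilon>: "0 < \<epsilon>" and opt: "0 < opt_lp M" and iter: "iteration M z h"
  shows "expected_revenue M (pin z h) - \<epsilon> * opt_lp M / T
    \<le> (\<integral>(h', c'). expected_revenue M (pin z h') \<partial>measure_pmf (alg4_step M z sel (num_runs M \<epsilon>) (h, c)))"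
proof -
  define K where "K = num_runs M \<epsilon>"
  interpret iteration M z h K by (rule iter)
  define g where "g = \<epsilon> * opt_lp M / T"
  have g: "0 < g" using \<epsilon> opt T_pos by (simp add: g_def)
  have card: "card candidates \<le> (if n * T = 1 then 1 else n + 2)"
    unfolding candidates_def using algorithm_support(2)[OF alg length_h] .
  have pos: "0 < card candidates" using candidates by (simp add: card_gt_0_iff)
  have "expected_revenue M (pin z h) - g
      \<le> (\<integral>(h', c'). expected_revenue M (pin z h') \<partial>measure_pmf (alg4_step M z sel K (h, c)))"
  proof (cases "n * T = 1")
    case True
    then have "card candidates = 1" using card pos by simp
    from single_candidate_expectation[OF sel this, of c] g show ?thesis by simp
  next
    case False
    define L where "L = ln (real n) + ln (real T)"
    have L: "0 < L" using ln_nT_pos[OF False] by (simp add: L_def)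
    have "card candidates \<le> (n * T)\<^sup>2" using card candidates_le_square[OF False] False by presburger
    then have "real (card candidates) \<le> real (n * T) ^ 2" by (metis of_nat_le_iff of_nat_power)
    then have "ln (card candidates) \<le> ln (real (n * T) ^ 2)"
      using pos n_pos T_pos by (subst ln_le_cancel_iff) auto
    also have "\<dots> = 2 * L"
      using n_pos T_pos by (simp add: L_def ln_realpow ln_mult)
    finally have ln: "ln (card candidates) \<le> 2 * L" .
    have "(real T)\<^sup>2 * R\<^sup>2 / (opt_lp M)\<^sup>2 * (1 / \<epsilon>\<^sup>2) * L \<le> K"
      unfolding L_def K_def by (rule num_runs_bounds)
    moreover have "(real T)\<^sup>2 * R\<^sup>2 / (opt_lp M)\<^sup>2 * (1 / \<epsilon>\<^sup>2) * L = R\<^sup>2 * L / g\<^sup>2"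
      using T_pos by (simp add: g_def power_mult_distrib power_divide mult_ac)
    ultimately have K: "R\<^sup>2 * L / g\<^sup>2 \<le> K" by simp
    have "0 < R\<^sup>2 * L / g\<^sup>2" using R_pos L g by (intro divide_pos_pos mult_pos_pos[of "R\<^sup>2"] zero_less_power)
    with K have Kpos: "0 < K" by (metis less_le_trans of_nat_0_less_iff)
    \<comment> \<open>This value splits the loss evenly: \<open>2 * L / l = g / 2\<close>, and
      \<open>l * R\<^sup>2 / (8 * K) \<le> g / 2\<close> by the lower bound on
      \<open>K\<close>.\<close>
    define l where "l = 4 * L / g"
    have l: "0 < l" using L g by (simp add: l_def)
    have "ln (card candidates) / l \<le> 2 * L / l" using ln l by (intro divide_right_mono) auto
    also have "\<dots> = g / 2" using L g by (simp add: l_def)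
    finally have 1: "ln (card candidates) / l \<le> g / 2" .
    have "l * R\<^sup>2 / (8 * K) = R\<^sup>2 * L / g\<^sup>2 * (g / (2 * K))"
      using g Kpos by (simp add: l_def field_simps power2_eq_square)
    also have "\<dots> \<le> K * (g / (2 * K))" using K g by (intro mult_right_mono) auto
    also have "\<dots> = g / 2" using Kpos by simp
    finally have "ln (card candidates) / l + l * R\<^sup>2 / (8 * K) \<le> g" using 1 by simp
    with alg4_step_loss[OF sel Kpos l, of c] show ?thesis by simp
  qed
  then show ?thesis by (simp add: g_def K_def)
qed

section \<open>Revenue guarantee and operation count of the whole algorithm\<close>

lemma algorithm4_revenue:
  assumes alg: "algorithm1 M z \<or> algorithm2 M z \<or> algorithm3 M z" and sel: "valid_tie_break sel"
    and \<epsilon>: "0 < \<epsilon>" and \<alpha>: "\<alpha> * opt_lp M \<le> expected_revenue M z"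
  shows "(\<alpha> - \<epsilon>) * opt_lp M
    \<le> (\<integral>(h, c). expected_revenue M (calendar h) \<partial>measure_pmf (algorithm4 M z sel \<epsilon>))"
\<comment> \<open>If the LP value is zero, the target is zero and revenue is nonnegative. Otherwise
  dividing by it is legitimate.\<close>
proof (cases "opt_lp M = 0")
  case True
  then show ?thesis
    using expected_revenue_nonneg by (auto intro!: Bochner_Integration.integral_nonneg)
next
  case False
  then have opt: "0 < opt_lp M" using opt_lp_bounds by simp
  let ?p = "algorithm4 M z sel \<epsilon>"
  note z = algorithm_support(1)[OF alg]
  have card: "card (set_pmf (z t)) \<le> n + 2" if "t < T" for t
    using algorithm_support(2)[OF alg that] by (simp split: if_splits)
  note cost = iteration_ops_le[OF _ card]
  have "(\<alpha> - \<epsilon>) * opt_lp M \<le> expected_revenue M z - T * (\<epsilon> * opt_lp M / T)"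
    using \<alpha> T_pos by (simp add: left_diff_distrib)
  also have "\<dots> \<le> (\<integral>(h, c). expected_revenue M (pin z h) \<partial>measure_pmf ?p)"
    unfolding algorithm4_def
    by (rule alg4_run_expectation[OF z sel cost alg4_step_loss_eps[OF alg sel \<epsilon> opt] order_refl])
  \<comment> \<open>After the last iteration every period below the horizon is pinned, so the pinned
    policy and the calendar agree there.\<close>
  also have "\<dots> = (\<integral>(h, c). expected_revenue M (calendar h) \<partial>measure_pmf ?p)"
  proof (intro integral_cong_AE)
    show "AE x in measure_pmf ?p. (case x of (h, c) \<Rightarrow> expected_revenue M (pin z h))
        = (case x of (h, c) \<Rightarrow> expected_revenue M (calendar h))"
      unfolding AE_measure_pmf_iff
    proof (clarify)
      fix h c assume "(h, c) \<in> set_pmf ?p"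
      then have "length h = T"
        using alg4_run_support(1)[OF z sel cost order_refl] unfolding algorithm4_def by blast
      then show "expected_revenue M (pin z h) = expected_revenue M (calendar h)"
        by (intro expected_revenue_cong) (simp add: pin_def calendar_def)
    qed
  qed auto
  finally show ?thesis .
qed

text \<open>The bound holds for every possible outcome, not just on average. Apart from rounding,
  the number of runs is \<open>x\<close>, and \<open>time_bound M \<epsilon>\<close> equals
  \<open>(n * T)\<^sup>2 * x\<close>.\<close>

lemma algorithm4_time:
  assumes alg: "algorithm1 M z \<or> algorithm2 M z \<or> algorithm3 M z" and sel: "valid_tie_break sel"
    and \<epsilon>: "0 < \<epsilon>" "\<epsilon> \<le> 1" and opt: "0 < opt_lp M" and nT: "2 \<le> n * T"
    and c: "(h, c) \<in> set_pmf (algorithm4 M z sel \<epsilon>)"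
  shows "real c \<le> 212 * time_bound M \<epsilon>"
proof -
  note z = algorithm_support(1)[OF alg]
  have card: "card (set_pmf (z t)) \<le> n + 2" if "t < T" for t
    using algorithm_support(2)[OF alg that] by (simp split: if_splits)
  note cost = iteration_ops_le[OF _ card]
  define K where "K = num_runs M \<epsilon>"
  define L where "L = ln (real n) + ln (real T)"
  define x where "x = (real T)\<^sup>2 * R\<^sup>2 / (opt_lp M)\<^sup>2 * (1 / \<epsilon>\<^sup>2) * L"
  have "c \<le> (n + 14) + T * (10 * n + 54 * n * n * T * K)"
    using alg4_run_support(1)[OF z sel cost order_refl c[unfolded algorithm4_def]]
    unfolding K_def by blast
  \<comment> \<open>\<open>25 = 1 + 14 + 10\<close>: the initial \<open>n + 14\<close> operations
    and the overhead \<open>10 * n\<close> of each period.\<close>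
  also have "\<dots> \<le> 25 * (n * T) + 54 * (n * T)\<^sup>2 * K"
  proof -
    have "n \<le> n * T" "1 \<le> n * T" using n_pos T_pos by auto
    moreover have "T * (10 * n + 54 * n * n * T * K) = 10 * (n * T) + 54 * (n * T)\<^sup>2 * K"
      by (simp add: power2_eq_square algebra_simps)
    ultimately show ?thesis by linarith
  qed
  also have "\<dots> \<le> 25 * (n * T)\<^sup>2 + 54 * (n * T)\<^sup>2 * K"
    using nT by (simp add: power2_eq_square)
  finally have "real c \<le> real (25 * (n * T)\<^sup>2 + 54 * (n * T)\<^sup>2 * K)" by (rule of_nat_mono)
  then have 1: "real c \<le> (n * T)\<^sup>2 * (25 + 54 * real K)" by (simp add: algebra_simps)
  \<comment> \<open>The factors other than \<open>L\<close> are at least 1, by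
    \<open>opt_lp M \<le> R\<close> and \<open>\<epsilon> \<le> 1\<close>, and
    \<open>L \<ge> 2 / 3\<close>.\<close>
  have "1 / 2 \<le> x"
  proof -
    have "n * T \<noteq> 1" using nT by linarith
    then have L: "1 / 2 \<le> L" using ln_nT_pos(1) unfolding L_def by linarith
    have "1 \<le> (real T)\<^sup>2" using T_pos by simp
    moreover have "1 \<le> R\<^sup>2 / (opt_lp M)\<^sup>2"
      using opt opt_lp_bounds by (simp add: power_mono)
    moreover have "1 \<le> 1 / \<epsilon>\<^sup>2" using \<epsilon> by (simp add: power_le_one)
    ultimately have "1 * 1 * 1 * (1 / 2) \<le> (real T)\<^sup>2 * (R\<^sup>2 / (opt_lp M)\<^sup>2) * (1 / \<epsilon>\<^sup>2) * L"
      using L by (intro mult_mono) auto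
    then show ?thesis by (simp add: x_def)
  qed
  moreover have "real K \<le> x + 1" unfolding K_def x_def L_def by (rule num_runs_bounds)
  \<comment> \<open>\<open>25 + 54 * (x + 1) = 79 + 54 * x\<close>, and
    \<open>79 \<le> 158 * x\<close> because \<open>x \<ge> 1 / 2\<close>.\<close>
  ultimately have "25 + 54 * real K \<le> 212 * x" by linarith
  then have "(n * T)\<^sup>2 * (25 + 54 * real K) \<le> (n * T)\<^sup>2 * (212 * x)" by (intro mult_left_mono) auto
  also have "\<dots> = 212 * time_bound M \<epsilon>"
    by (simp add: x_def L_def time_bound_def power_mult_distrib)
  finally show ?thesis using 1 by simp
qed

end

text \<open>The side conditions of the time bound exclude degenerate values: the count starts at
  \<open>num_items M + 14\<close>, whereas \<open>time_bound\<close> is zero for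
  \<open>n = T = 1\<close> and, by the convention for division by zero, for
  \<open>opt_lp M = 0\<close>; it also tends to zero as \<open>\<epsilon>\<close> grows. The
  constant \<open>C\<close> is uniform over all models, policies and tie-breaking rules.\<close>

theorem theorem4:
  shows "(\<forall>(M :: model) (z :: policy) (sel :: tie_break) (\<alpha> :: real) (\<epsilon> :: real).
            valid_model M \<longrightarrow> algorithm1 M z \<or> algorithm2 M z \<or> algorithm3 M z \<longrightarrow>
            valid_tie_break sel \<longrightarrow> 0 < \<epsilon> \<longrightarrow>
            \<alpha> * opt_lp M \<le> expected_revenue M z \<longrightarrow>
            (\<alpha> - \<epsilon>) * opt_lp M
              \<le> (\<integral>(h, c). expected_revenue M (calendar h) \<partial>measure_pmf (algorithm4 M z sel \<epsilon>)))
       \<and> (\<exists>C :: real. \<forall>(M :: model) (z :: policy) (sel :: tie_break) (\<epsilon> :: real).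
            valid_model M \<longrightarrow> algorithm1 M z \<or> algorithm2 M z \<or> algorithm3 M z \<longrightarrow>
            valid_tie_break sel \<longrightarrow>
            0 < \<epsilon> \<longrightarrow> \<epsilon> \<le> 1 \<longrightarrow> 0 < opt_lp M \<longrightarrow> 2 \<le> num_items M * horizon M \<longrightarrow>
            (\<forall>(h, c)\<in>set_pmf (algorithm4 M z sel \<epsilon>). real c \<le> C * time_bound M \<epsilon>))"
  using valid.algorithm4_revenue valid.algorithm4_time unfolding valid_def by blast

end
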